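(* Let $m \ge 1$, and let $f_i : \mathbb{R}^n \times \mathbb{R}^{n_i} \to \mathbb{R}$ and $V_i \subseteq \mathbb{R}^{n+n_i}$, $i=1,\ldots,m$, define the problem $$\mathcal{P}: \quad \min_{x \in \mathbb{R}^n,\ \{u_i \in \mathbb{R}^{n_i}\}_{i=1}^m} \ \sum_{i=1}^m f_i(x,u_i) \quad \text{subject to } (x,u_i) \in V_i \text{ for all } i=1,\ldots,m .$$ Suppose that Assumptions A1–A6 listed in the context hold, and let $\{x_i(k)\}_{k\ge 0}$, $\{u_i(k)\}_{k \ge 0}$, $i=1,\ldots,m$, be the sequences of estimates generated by the distributed algorithm described in the context. Then: 1. there exists a vector $x^* \in \mathbb{R}^n$ that is the $x$-component of some minimizer of $\mathcal{P}$, such that $\lim_{k\to\infty} \|x_i(k) - x^*\| = 0$ for all $i=1,\ldots,m$; 2. for any limit point $(u_1^*,\ldots,u_m^* )$ of the sequence $\{(u_1(k),\ldots,u_m(k))\}_{k\ge 0}$, the tuple $(x^*,u_1^*,\ldots,u_m^* )$ is a minimizer of $\mathcal{P}$.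
   Context: $\|\cdot\|$ denotes the Euclidean norm. For $i=1,\ldots,m$ define $$U_i(x) = \{u_i \in \mathbb{R}^{n_i} : (x,u_i) \in V_i\} \ (x\in\mathbb{R}^n), \qquad X_i = \{x \in \mathbb{R}^n : \exists\, u_i \in \mathbb{R}^{n_i} \text{ such that } (x,u_i) \in V_i\}.$$ **Algorithm.** Given positive numbers $c(k)$ and weights $a_j^i(k)$, $i,j\in\{1,\ldots,m\}$, $k\ge 0$, start with arbitrary $x_i(0)\in\mathbb{R}^n$, $u_i(0)\in\mathbb{R}^{n_i}$ such that $(x_i(0),u_i(0)) \in V_i$ for all $i$. For $k = 0,1,2,\ldots$ and every $i=1,\ldots,m$, set $$\bar{x}_i(k) = \sum_{j=1}^m a_j^i(k)\, x_j(k),$$ $$(x_i(k+1),u_i(k+1)) \in \arg\min_{(x_i,u_i) \in V_i} \ f_i(x_i,u_i) + \frac{1}{2c(k)} \|\bar{x}_i(k) - x_i\|^2 .$$ If there are multiple minimizers, the same deterministic tie-break rule is used at every iteration to select one. **Assumptions.** A1. For all $i$, $f_i$ is jointly convex and jointly Lipschitz continuous with respect to its arguments $(x,u_i)$. A2. For all $i$, $V_i$ is compact and convex. Moreover, the set $\{(x,u_1,\ldots,u_m) \in \mathbb{R}^{n+n_1+\cdots+n_m} : (x,u_i)\in V_i \text{ for all } i=1,\ldots,m\}$ has non-empty interior. A3. For all $i$, the set-valued mapping $U_i$ is Lipschitz continuous on $X_i$: there exists $L_i>0$ such that $d_H(U_i(x),U_i(x')) \le L_i \|x-x'\|$ for all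 $x,x'\in X_i$, where $$d_H(U_i(x),U_i(x')) = \sup_{u_i\in\mathbb{R}^{n_i}} \Big| \min_{v_i\in U_i(x)} \|u_i - v_i\| - \min_{v_i'\in U_i(x')} \|u_i - v_i'\| \Big|$$ is the Pompeiu–Hausdorff distance. A4. $\{c(k)\}_{k\ge 0}$ is a non-increasing sequence with $c(k)>0$ for all $k$, $\sum_{k=0}^\infty c(k) = \infty$ and $\sum_{k=0}^\infty c(k)^2 < \infty$. A5. There exists $\eta\in(0,1)$ such that for all $i,j\in\{1,\ldots,m\}$ and all $k\ge 0$: $a_j^i(k)\ge 0$, $a_i^i(k)\ge\eta$, and $a_j^i(k)>0$ implies $a_j^i(k)\ge\eta$. Moreover, for all $k\ge 0$, $\sum_{j=1}^m a_j^i(k) = 1$ for all $i$, and $\sum_{i=1}^m a_j^i(k) = 1$ for all $j$. A6. Let $N=\{1,\ldots,m\}$, $E_k = \{(j,i) : a_j^i(k)>0\}$ (agent $i$ receives information from agent $j$ at iteration $k$), and $E_\infty = \{(j,i) : (j,i)\in E_k \text{ for infinitely many } k\}$. The directed graph $(N,E_\infty)$ is strongly connected, i.e., for any two nodes there exists a path of directed edges connecting them. Moreover, there exists $\bar{k}\ge 1$ such that for every $(j,i)\in E_\infty$, agent $i$ receives information from agent $j$ at least once every $\bar{k}$ consecutive iterations, i.e., $(j,i)\in E_k\cup E_{k+1}\cup\cdots\cup E_{k+\bar{k}-1}$ for every $k\ge 0$. *)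

theory Defs
  imports "HOL-Analysis.Analysis"
begin

text \<open>
  Agents are the elements of a finite type \<open>'m\<close>. The local dimensions $n_i$ may differ from agent
  to agent, so $R^{n_i}$ is modelled as the space of vectors of \<open>real ^ 'p\<close> supported on a set
  \<open>D i\<close> of coordinates, with $n_i = $ \<open>card (D i)\<close>. Every family $(n_i)_i$ arises this way, for
  any \<open>'p\<close> with at least $\max_i n_i$ elements.
\<close>

definition coord_space :: "'p set \<Rightarrow> (real ^ 'p) set" where
  "coord_space D = {u. \<forall>l. l \<notin> D \<longrightarrow> u $ l = 0}"

text \<open>The product of $R^n$ and all the $R^{n_i}$, as a subspace of the type of joint decision vectors.\<close>

definition joint_space :: "('m \<Rightarrow> 'p set) \<Rightarrow> ((real ^ 'n) \<times> ((real ^ 'p) ^ 'm)) set" where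
  "joint_space D = {(x, u). \<forall>i. u $ i \<in> coord_space (D i)}"

definition feasible_set ::
  "('m \<Rightarrow> ((real ^ 'n) \<times> (real ^ 'p)) set) \<Rightarrow> ((real ^ 'n) \<times> ((real ^ 'p) ^ 'm)) set" where
  "feasible_set V = {(x, u). \<forall>i. (x, u $ i) \<in> V i}"

definition is_minimizer ::
  "('m::finite \<Rightarrow> (real ^ 'n) \<times> (real ^ 'p) \<Rightarrow> real) \<Rightarrow>
   ('m \<Rightarrow> ((real ^ 'n) \<times> (real ^ 'p)) set) \<Rightarrow> real ^ 'n \<Rightarrow> (real ^ 'p) ^ 'm \<Rightarrow> bool" where
  "is_minimizer f V x u \<longleftrightarrow>
     is_arg_min (\<lambda>(x, u). \<Sum>i\<in>UNIV. f i (x, u $ i)) (\<lambda>z. z \<in> feasible_set V) (x, u)"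

definition slice :: "('a \<times> 'b) set \<Rightarrow> 'a \<Rightarrow> 'b set" where
  "slice V x = {u. (x, u) \<in> V}"

definition slice_domain :: "('a \<times> 'b) set \<Rightarrow> 'a set" where
  "slice_domain V = {x. \<exists>u. (x, u) \<in> V}"

text \<open>
  The Pompeiu--Hausdorff distance of two subsets of the space \<open>E\<close>. For nonempty compact \<open>A\<close> the
  infimum in \<open>infdist u A\<close> is a minimum, and for nonempty bounded \<open>A\<close> and \<open>B\<close> the supremum is
  finite. It is only applied to such sets (slices of a compact set over points of its domain).
\<close>

definition pompeiu_hausdorff :: "'a::metric_space set \<Rightarrow> 'a set \<Rightarrow> 'a set \<Rightarrow> real" where
  "pompeiu_hausdorff E A B = (SUP u\<in>E. \<bar>infdist u A - infdist u B\<bar>)"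

definition prox_minimizers ::
  "((real ^ 'n) \<times> (real ^ 'p) \<Rightarrow> real) \<Rightarrow> ((real ^ 'n) \<times> (real ^ 'p)) set \<Rightarrow>
   real \<Rightarrow> real ^ 'n \<Rightarrow> ((real ^ 'n) \<times> (real ^ 'p)) set" where
  "prox_minimizers f V c xbar =
     {z. is_arg_min (\<lambda>(y, v). f (y, v) + 1 / (2 * c) * (norm (xbar - y))\<^sup>2) (\<lambda>z. z \<in> V) z}"

text \<open>
  \<open>a i j k\<close> is the weight $a^i_j(k)$ that agent \<open>i\<close> gives to agent \<open>j\<close> at iteration \<open>k\<close>.
  The tie-break rule \<open>tb i\<close> of agent \<open>i\<close> is a fixed function of the set of minimizers,
  independent of the iteration.
\<close>

definition algorithm_run ::
  "('m::finite \<Rightarrow> (real ^ 'n) \<times> (real ^ 'p) \<Rightarrow> real) \<Rightarrow>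
   ('m \<Rightarrow> ((real ^ 'n) \<times> (real ^ 'p)) set) \<Rightarrow> (nat \<Rightarrow> real) \<Rightarrow> ('m \<Rightarrow> 'm \<Rightarrow> nat \<Rightarrow> real) \<Rightarrow>
   ('m \<Rightarrow> ((real ^ 'n) \<times> (real ^ 'p)) set \<Rightarrow> (real ^ 'n) \<times> (real ^ 'p)) \<Rightarrow>
   ('m \<Rightarrow> nat \<Rightarrow> real ^ 'n) \<Rightarrow> ('m \<Rightarrow> nat \<Rightarrow> real ^ 'p) \<Rightarrow> bool" where
  "algorithm_run f V c a tb x u \<longleftrightarrow>
     (\<forall>i. (x i 0, u i 0) \<in> V i) \<and>
     (\<forall>k i. let xbar = (\<Sum>j\<in>UNIV. a i j k *\<^sub>R x j k);
                M = prox_minimizers (f i) (V i) (c k) xbar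
            in (x i (Suc k), u i (Suc k)) \<in> M \<and> (x i (Suc k), u i (Suc k)) = tb i M)"

definition comm_edges :: "('m \<Rightarrow> 'm \<Rightarrow> nat \<Rightarrow> real) \<Rightarrow> nat \<Rightarrow> ('m \<times> 'm) set" where
  "comm_edges a k = {(j, i). a i j k > 0}"

definition comm_edges_inf :: "('m \<Rightarrow> 'm \<Rightarrow> nat \<Rightarrow> real) \<Rightarrow> ('m \<times> 'm) set" where
  "comm_edges_inf a = {e. infinite {k. e \<in> comm_edges a k}}"

definition limit_point :: "(nat \<Rightarrow> 'a::topological_space) \<Rightarrow> 'a \<Rightarrow> bool" where
  "limit_point s l \<longleftrightarrow> (\<exists>r. strict_mono r \<and> (\<lambda>k. s (r k)) \<longlonglongrightarrow> l)"

end

theory Submission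
  imports Defs
begin

text \<open>
  Write \<open>e i k\<close> for the difference between the new iterate \<open>x i (Suc k)\<close> and the weighted average
  of the old iterates from which agent \<open>i\<close> computes it, and \<open>d k\<close> for the total distance of the
  iterates \<open>x i k\<close> from their mean (\<open>deviation\<close>). The proof balances two estimates.

  \<^item> Descent. By strong convexity of the proximal term, one step can be compared with any feasible
    point \<open>z = (y, w)\<close>: the sum of the squared distances from the iterates to \<open>y\<close> decreases by at
    least the sum of the squared norms of the \<open>e i k\<close>, plus \<open>2 * c k\<close> times the excess of the cost
    of the new iterates over that of \<open>z\<close> (\<open>one_step_descent\<close>). Averaging costs nothing because the weights are doubly stochastic.
    But when \<open>z\<close> is optimal the excess need not be nonnegative, since the agents disagree and the
    iterates do not form a feasible point. There is however a feasible point at distance \<open>O (d k)\<close>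
    from all iterates \<open>x i k\<close>, whose cost exceeds theirs by \<open>O (d k)\<close> only
    (\<open>feasible_point_near\<close>). Moving towards an interior point of the common domain produces its
    \<open>x\<close>-component, and the Lipschitz dependence of the slices produces its local variables. So the
    damage done by disagreement in step \<open>k\<close> is \<open>O (c k * d (Suc k))\<close>.

  \<^item> Consensus. Over a window of fixed length the product of the weight matrices has all entries
    bounded below, so disagreement contracts by a fixed factor, up to the errors \<open>e i k\<close>
    (\<open>deviation_window\<close>). Hence the sum of the \<open>(d k)\<^sup>2\<close> is bounded by a constant plus a multiple of
    the sum of the squared errors (\<open>deviation_square_sum\<close>).

  Young's inequality splits \<open>c k * d (Suc k)\<close> into a large multiple of \<open>(c k)\<^sup>2\<close>, which is summable,
  and a small multiple of \<open>(d (Suc k))\<^sup>2\<close>, which by the consensus bound is absorbed by the squared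
  errors on the left of the descent inequality (\<open>descent_summable\<close>). This gives that \<open>d\<close> is square
  summable, hence tends to 0, and that \<open>c k\<close> times the suboptimality of the feasible point near the
  iterates of time \<open>Suc k\<close> is summable. As \<open>c\<close> is not summable, these points have a subsequence with cost tending to the
  optimum, and by compactness a further one converging to a minimizer \<open>\<zeta>\<close>. The sum of
  the squared distances from the iterates to the \<open>x\<close>-component of \<open>\<zeta>\<close> is decreasing up to summable
  errors, hence converges, and tends to 0 along the subsequence; so it tends to 0 (\<open>iterates_converge\<close>).

  For the local variables, \<open>u i (Suc k)\<close> is optimal in the slice over \<open>x i (Suc k)\<close>, and the slices
  vary continuously, so optimality over the limiting slice passes to limit points
  (\<open>limit_point_is_minimizer\<close>).
\<close>

section \<open>Deviation from the mean\<close>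

definition mean :: "('m::finite \<Rightarrow> 'v::real_normed_vector) \<Rightarrow> 'v" where
  "mean y = (1 / real CARD('m)) *\<^sub>R (\<Sum>i\<in>UNIV. y i)"

definition deviation :: "('m::finite \<Rightarrow> 'v::real_normed_vector) \<Rightarrow> real" where
  "deviation y = (\<Sum>i\<in>UNIV. norm (y i - mean y))"

lemma deviation_nonneg: "deviation y \<ge> 0"
  by (simp add: deviation_def sum_nonneg)

lemma norm_diff_mean_le_deviation: "norm (y i - mean y) \<le> deviation y"
  unfolding deviation_def by (rule member_le_sum) auto

lemma sum_diff_mean:
  fixes y :: "'m::finite \<Rightarrow> 'v::real_normed_vector"
  shows "(\<Sum>i\<in>UNIV. y i - mean y) = 0"
  by (simp add: sum_subtractf mean_def sum_constant_scaleR)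

text \<open>
  The factor 2 pays once for the entries and once for the mean, which moves by at most the average
  of the individual displacements.
\<close>
lemma deviation_perturbation:
  fixes y z :: "'m::finite \<Rightarrow> 'v::real_normed_vector"
  shows "deviation y \<le> deviation z + 2 * (\<Sum>i\<in>UNIV. norm (y i - z i))"
proof -
  let ?S = "\<Sum>i\<in>UNIV. norm (y i - z i)"
  have "mean z - mean y = (1 / real CARD('m)) *\<^sub>R (\<Sum>i\<in>UNIV. z i - y i)"
    by (simp add: mean_def sum_subtractf scaleR_diff_right)
  also have "norm \<dots> \<le> (1 / real CARD('m)) * ?S"
    using norm_sum[of "\<lambda>i. z i - y i" UNIV]
    by (simp add: norm_minus_commute divide_right_mono)
  finally have m: "norm (mean z - mean y) \<le> (1 / real CARD('m)) * ?S" .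
  have "deviation y \<le> (\<Sum>i\<in>UNIV. norm (z i - mean z) + norm (y i - z i) + norm (mean z - mean y))"
    unfolding deviation_def
  proof (rule sum_mono)
    fix i
    have "y i - mean y = (z i - mean z) + (y i - z i) + (mean z - mean y)" by simp
    then show "norm (y i - mean y) \<le> norm (z i - mean z) + norm (y i - z i) + norm (mean z - mean y)"
      by (metis norm_triangle_le norm_triangle_ineq add_right_mono order_trans)
  qed
  also have "\<dots> = deviation z + ?S + real CARD('m) * norm (mean z - mean y)"
    by (simp add: sum.distrib deviation_def)
  also have "\<dots> \<le> deviation z + 2 * ?S"
    using mult_left_mono[OF m, of "real CARD('m)"] by simp
  finally show ?thesis .
qed

text \<open>
  The deviations from the mean sum to zero, so \<open>\<delta>\<close> may be subtracted from every entry of \<open>P\<close>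
  without changing its action on them. What is left is a nonnegative matrix whose columns have sum
  \<open>1 - m * \<delta>\<close>, where \<open>m\<close> is the number of agents.
\<close>
lemma deviation_contraction:
  fixes y :: "'m::finite \<Rightarrow> 'v::real_normed_vector" and P :: "'m \<Rightarrow> 'm \<Rightarrow> real"
  assumes row: "\<And>i. (\<Sum>j\<in>UNIV. P i j) = 1"
    and column: "\<And>j. (\<Sum>i\<in>UNIV. P i j) = 1"
    and entry: "\<And>i j. P i j \<ge> \<delta>"
  shows "deviation (\<lambda>i. \<Sum>j\<in>UNIV. P i j *\<^sub>R y j) \<le> (1 - real CARD('m) * \<delta>) * deviation y"
proof -
  have "(\<Sum>i\<in>UNIV. \<Sum>j\<in>UNIV. P i j *\<^sub>R y j) = (\<Sum>j\<in>UNIV. (\<Sum>i\<in>UNIV. P i j) *\<^sub>R y j)"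
    by (subst sum.swap) (simp add: scaleR_sum_left)
  then have mean_eq: "mean (\<lambda>i. \<Sum>j\<in>UNIV. P i j *\<^sub>R y j) = mean y"
    by (simp add: mean_def column)
  have shift: "(\<Sum>j\<in>UNIV. P i j *\<^sub>R y j) - mean y = (\<Sum>j\<in>UNIV. (P i j - \<delta>) *\<^sub>R (y j - mean y))" for i
  proof -
    have "(\<Sum>j\<in>UNIV. (P i j - \<delta>) *\<^sub>R (y j - mean y)) =
        (\<Sum>j\<in>UNIV. P i j *\<^sub>R (y j - mean y)) - \<delta> *\<^sub>R (\<Sum>j\<in>UNIV. y j - mean y)"
      unfolding scaleR_sum_right by (simp only: scaleR_diff_left sum_subtractf)
    also have "\<dots> = (\<Sum>j\<in>UNIV. P i j *\<^sub>R (y j - mean y))"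
      by (simp only: sum_diff_mean scaleR_zero_right diff_zero)
    also have "\<dots> = (\<Sum>j\<in>UNIV. P i j *\<^sub>R y j) - (\<Sum>j\<in>UNIV. P i j) *\<^sub>R mean y"
      by (simp add: scaleR_diff_right sum_subtractf scaleR_sum_left)
    finally show ?thesis by (simp add: row)
  qed
  have "deviation (\<lambda>i. \<Sum>j\<in>UNIV. P i j *\<^sub>R y j)
      = (\<Sum>i\<in>UNIV. norm (\<Sum>j\<in>UNIV. (P i j - \<delta>) *\<^sub>R (y j - mean y)))"
    by (simp add: deviation_def mean_eq shift)
  also have "\<dots> \<le> (\<Sum>i\<in>UNIV. \<Sum>j\<in>UNIV. (P i j - \<delta>) * norm (y j - mean y))"
    by (intro sum_mono order_trans[OF norm_sum]) (simp add: entry)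
  also have "\<dots> = (\<Sum>j\<in>UNIV. (\<Sum>i\<in>UNIV. P i j - \<delta>) * norm (y j - mean y))"
    by (subst sum.swap) (simp add: sum_distrib_right)
  also have "\<dots> = (1 - real CARD('m) * \<delta>) * deviation y"
    by (simp add: sum_subtractf column deviation_def sum_distrib_left)
  finally show ?thesis .
qed

section \<open>Products of doubly stochastic weight matrices\<close>

text \<open>
  \<open>transition a k s\<close> is the product of the \<open>s\<close> weight matrices of the times \<open>k, \<dots>, k + s - 1\<close>, the
  latest on the left. Its entry at \<open>(i, j)\<close> is the influence of agent \<open>j\<close> at time \<open>k\<close> on agent \<open>i\<close>
  at time \<open>k + s\<close>.
\<close>
primrec transition :: "('m::finite \<Rightarrow> 'm \<Rightarrow> nat \<Rightarrow> real) \<Rightarrow> nat \<Rightarrow> nat \<Rightarrow> 'm \<Rightarrow> 'm \<Rightarrow> real" where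
  "transition a k 0 i j = (if i = j then 1 else 0)"
| "transition a k (Suc s) i j = (\<Sum>l\<in>UNIV. a i l (k + s) * transition a k s l j)"

locale mixing_weights =
  fixes a :: "'m::finite \<Rightarrow> 'm \<Rightarrow> nat \<Rightarrow> real" and \<eta> :: real and kbar :: nat
  assumes eta_pos: "\<eta> > 0"
    and weight_nonneg: "a i j k \<ge> 0"
    and self_weight: "a i i k \<ge> \<eta>"
    and weight_pos: "a i j k > 0 \<Longrightarrow> a i j k \<ge> \<eta>"
    and row_sum: "(\<Sum>j\<in>UNIV. a i j k) = 1"
    and column_sum: "(\<Sum>i\<in>UNIV. a i j k) = 1"
    and connected: "(i, j) \<in> (comm_edges_inf a)\<^sup>*"
    and window: "e \<in> comm_edges_inf a \<Longrightarrow> \<exists>l\<in>{k..<k + kbar}. e \<in> comm_edges a l"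
begin

lemma transition_nonneg: "transition a k s i j \<ge> 0"
  by (induction s arbitrary: i) (auto intro!: sum_nonneg mult_nonneg_nonneg weight_nonneg)

lemma transition_row_sum: "(\<Sum>j\<in>UNIV. transition a k s i j) = 1"
proof (induction s arbitrary: i)
  case (Suc s)
  have "(\<Sum>j\<in>UNIV. transition a k (Suc s) i j) =
      (\<Sum>l\<in>UNIV. a i l (k + s) * (\<Sum>j\<in>UNIV. transition a k s l j))"
    unfolding transition.simps by (subst sum.swap) (simp add: sum_distrib_left)
  then show ?case by (simp add: Suc row_sum)
qed simp

lemma transition_column_sum: "(\<Sum>i\<in>UNIV. transition a k s i j) = 1"
proof (induction s)
  case (Suc s)
  have "(\<Sum>i\<in>UNIV. transition a k (Suc s) i j) =
      (\<Sum>l\<in>UNIV. (\<Sum>i\<in>UNIV. a i l (k + s)) * transition a k s l j)"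
    unfolding transition.simps by (subst sum.swap) (simp add: sum_distrib_right)
  then show ?case by (simp add: Suc column_sum)
qed simp

lemma transition_Suc_ge:
  assumes "a i l (k + s) \<ge> \<eta>" "transition a k s l j \<ge> \<eta> ^ s"
  shows "transition a k (Suc s) i j \<ge> \<eta> ^ Suc s"
proof -
  have "\<eta> ^ Suc s \<le> a i l (k + s) * transition a k s l j"
    using mult_mono[OF assms] eta_pos weight_nonneg by simp
  also have "\<dots> \<le> transition a k (Suc s) i j"
    unfolding transition.simps
    by (rule member_le_sum) (auto intro!: mult_nonneg_nonneg weight_nonneg transition_nonneg)
  finally show ?thesis .
qed

text \<open>
  Once agent \<open>j\<close> has influenced agent \<open>i\<close>, the self-weight of \<open>i\<close> keeps the influence alive at the
  price of one factor \<open>\<eta>\<close> per step.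
\<close>
lemma transition_ge_persists:
  assumes "transition a k s i j \<ge> \<eta> ^ s" "s \<le> t"
  shows "transition a k t i j \<ge> \<eta> ^ t"
  using assms(2) assms(1)
  by (induction t rule: dec_induct) (blast intro: transition_Suc_ge self_weight)+

text \<open>
  Influence travels along a path one edge per window: wait for the next edge of the path to be
  active, cross it, and wait for the end of the window.
\<close>
lemma transition_path_ge:
  assumes "(j, i) \<in> comm_edges_inf a ^^ p"
  shows "transition a k (p * kbar) i j \<ge> \<eta> ^ (p * kbar)"
  using assms
proof (induction p arbitrary: i)
  case (Suc p)
  then obtain l where l: "(j, l) \<in> comm_edges_inf a ^^ p" "(l, i) \<in> comm_edges_inf a"
    by auto
  obtain t where t: "k + p * kbar \<le> t" "t < k + p * kbar + kbar" "(l, i) \<in> comm_edges a t"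
    using window[OF l(2), of "k + p * kbar"] by auto
  define s where "s = t - k"
  have s: "p * kbar \<le> s" "Suc s \<le> Suc p * kbar" "k + s = t"
    using t by (auto simp: s_def)
  have "transition a k s l j \<ge> \<eta> ^ s"
    using transition_ge_persists[OF Suc.IH[OF l(1)] s(1)] .
  moreover have "a i l (k + s) \<ge> \<eta>"
    using t(3) s(3) by (auto simp: comm_edges_def intro: weight_pos)
  ultimately have "transition a k (Suc s) i j \<ge> \<eta> ^ Suc s"
    by (rule transition_Suc_ge[rotated])
  from transition_ge_persists[OF this s(2)] show ?case .
qed auto

text \<open>
  Any two agents are joined by a path, and influence that arrives early persists. So the length of
  the longest of the finitely many chosen paths, counted in windows, serves all pairs at once.
\<close>
lemma transition_uniformly_positive: "\<exists>T. \<forall>k i j. transition a k T i j \<ge> \<eta> ^ T"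
proof -
  have "\<exists>p. (snd z, fst z) \<in> comm_edges_inf a ^^ p" for z :: "'m \<times> 'm"
    using connected[of "snd z" "fst z"] by (simp add: rtrancl_power)
  then obtain p where "\<And>z. (snd z, fst z) \<in> comm_edges_inf a ^^ p z"
    by metis
  then have p: "(j, i) \<in> comm_edges_inf a ^^ p (i, j)" for i j
    by (metis fst_conv snd_conv)
  define P where "P = Max (range p)"
  have "transition a k (P * kbar) i j \<ge> \<eta> ^ (P * kbar)" for k i j
  proof (rule transition_ge_persists[OF transition_path_ge[OF p]])
    show "p (i, j) * kbar \<le> P * kbar"
      unfolding P_def by (intro mult_right_mono Max_ge) auto
  qed
  then show ?thesis by blast
qed

text \<open>
  Iterating the perturbed averaging differs from applying the matrix product by at most the
  accumulated perturbations: since the columns have sum 1, averaging does not enlarge the sum of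
  the norms of the errors made so far.
\<close>
lemma perturbed_averaging:
  fixes x :: "'m \<Rightarrow> nat \<Rightarrow> 'v::real_normed_vector"
  shows "(\<Sum>i\<in>UNIV. norm (x i (k + s) - (\<Sum>j\<in>UNIV. transition a k s i j *\<^sub>R x j k)))
    \<le> (\<Sum>r<s. \<Sum>i\<in>UNIV. norm (x i (Suc (k + r)) - (\<Sum>j\<in>UNIV. a i j (k + r) *\<^sub>R x j (k + r))))"
proof (induction s)
  case 0
  have "(if i = j then 1 else 0 :: real) *\<^sub>R x j k = (if i = j then x j k else 0)" for i j by simp
  then show ?case by simp
next
  case (Suc s)
  define e where "e r i = x i (Suc (k + r)) - (\<Sum>j\<in>UNIV. a i j (k + r) *\<^sub>R x j (k + r))" for r i
  define R where "R s i = x i (k + s) - (\<Sum>j\<in>UNIV. transition a k s i j *\<^sub>R x j k)" for s i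
  have R_Suc: "R (Suc s) i = e s i + (\<Sum>l\<in>UNIV. a i l (k + s) *\<^sub>R R s l)" for i
  proof -
    have "(\<Sum>j\<in>UNIV. transition a k (Suc s) i j *\<^sub>R x j k) =
        (\<Sum>l\<in>UNIV. a i l (k + s) *\<^sub>R (\<Sum>j\<in>UNIV. transition a k s l j *\<^sub>R x j k))"
      unfolding transition.simps scaleR_sum_left scaleR_sum_right
      by (subst sum.swap) simp
    then show ?thesis
      by (simp add: R_def e_def scaleR_diff_right sum_subtractf)
  qed
  have "(\<Sum>i\<in>UNIV. norm (R (Suc s) i)) \<le>
      (\<Sum>i\<in>UNIV. norm (e s i) + (\<Sum>l\<in>UNIV. a i l (k + s) * norm (R s l)))"
  proof (rule sum_mono)
    fix i
    have "norm (\<Sum>l\<in>UNIV. a i l (k + s) *\<^sub>R R s l) \<le> (\<Sum>l\<in>UNIV. a i l (k + s) * norm (R s l))"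
      by (rule order_trans[OF norm_sum]) (simp add: weight_nonneg)
    then show "norm (R (Suc s) i) \<le> norm (e s i) + (\<Sum>l\<in>UNIV. a i l (k + s) * norm (R s l))"
      unfolding R_Suc by (rule norm_triangle_mono[OF order_refl])
  qed
  also have "\<dots> = (\<Sum>i\<in>UNIV. norm (e s i)) + (\<Sum>l\<in>UNIV. (\<Sum>i\<in>UNIV. a i l (k + s)) * norm (R s l))"
    unfolding sum.distrib sum_distrib_right
    using sum.swap[of "\<lambda>i l. a i l (k + s) * norm (R s l)" UNIV UNIV] by simp
  also have "\<dots> = (\<Sum>i\<in>UNIV. norm (e s i)) + (\<Sum>l\<in>UNIV. norm (R s l))"
    by (simp add: column_sum)
  finally show ?case
    using Suc unfolding R_def e_def by simp
qed

text \<open>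
  Over the window the iterates are those of exact averaging, which contracts the deviation, up to
  the accumulated errors.
\<close>
lemma deviation_window:
  "\<exists>T q. 0 \<le> q \<and> q < 1 \<and> (\<forall>(x :: 'm \<Rightarrow> nat \<Rightarrow> 'v::real_normed_vector) k.
    deviation (\<lambda>i. x i (k + T)) \<le> q * deviation (\<lambda>i. x i k) + 2 * (\<Sum>r<T. \<Sum>i\<in>UNIV.
      norm (x i (Suc (k + r)) - (\<Sum>j\<in>UNIV. a i j (k + r) *\<^sub>R x j (k + r)))))"
proof -
  obtain T where T: "\<And>k i j. transition a k T i j \<ge> \<eta> ^ T"
    using transition_uniformly_positive by blast
  define q where "q = 1 - real CARD('m) * \<eta> ^ T"
  have "real CARD('m) * \<eta> ^ T \<le> (\<Sum>j\<in>UNIV. transition a 0 T i j)" for i :: 'm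
    using sum_mono[of UNIV "\<lambda>_. \<eta> ^ T" "transition a 0 T i"] T by simp
  then have "0 \<le> q" by (simp add: q_def transition_row_sum)
  moreover have "q < 1" using eta_pos by (simp add: q_def)
  moreover have "deviation (\<lambda>i. x i (k + T)) \<le> q * deviation (\<lambda>i. x i k) + 2 * (\<Sum>r<T. \<Sum>i\<in>UNIV.
      norm (x i (Suc (k + r)) - (\<Sum>j\<in>UNIV. a i j (k + r) *\<^sub>R x j (k + r))))"
    for x :: "'m \<Rightarrow> nat \<Rightarrow> 'v" and k
  proof -
    have "deviation (\<lambda>i. \<Sum>j\<in>UNIV. transition a k T i j *\<^sub>R x j k) \<le> q * deviation (\<lambda>i. x i k)"
      unfolding q_def
      by (rule deviation_contraction) (auto simp: transition_row_sum transition_column_sum T)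
    then show ?thesis
      using deviation_perturbation[of "\<lambda>i. x i (k + T)" "\<lambda>i. \<Sum>j\<in>UNIV. transition a k T i j *\<^sub>R x j k"]
        perturbed_averaging[of x k T] by linarith
  qed
  ultimately show ?thesis by blast
qed

end

text \<open>
  Convexity of the square turns the recursion for \<open>d\<close> into one for \<open>d\<^sup>2\<close>. Summed over time, it
  compares the sum of the \<open>(d k)\<^sup>2\<close> with \<open>q < 1\<close> times itself; the first \<open>T\<close> terms go into \<open>C0\<close>.
  The sum on the left runs up to \<open>K\<close>, one term beyond that on the right: \<open>d K\<close> depends on \<open>g\<close> at
  earlier times only. This matters below, where the deviation after a step is charged to the error
  made in that step.
\<close>
lemma square_sum_recursion:
  fixes d g :: "nat \<Rightarrow> real"
  assumes q: "0 \<le> q" "q < 1" and d: "\<And>k. d k \<ge> 0"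
    and rec: "\<And>k. d (k + T) \<le> q * d k + (\<Sum>r<T. g (k + r))"
  shows "\<exists>C0. \<exists>C1\<ge>0. \<forall>K. (\<Sum>k\<le>K. (d k)\<^sup>2) \<le> C0 + C1 * (\<Sum>k<K. (g k)\<^sup>2)"
proof -
  define S where "S K = (\<Sum>k\<le>K. (d k)\<^sup>2)" for K
  define A where "A = (\<Sum>k<T. (d k)\<^sup>2)"
  have sq: "(d (k + T))\<^sup>2 \<le> q * (d k)\<^sup>2 + T / (1 - q) * (\<Sum>r<T. (g (k + r))\<^sup>2)" for k
  proof -
    define W where "W = (\<Sum>r<T. g (k + r))"
    have "(d (k + T))\<^sup>2 \<le> (q * d k + W)\<^sup>2"
      using rec[of k] d by (intro power_mono) (auto simp: W_def)
    \<comment> \<open>convexity of the square, applied to \<open>q * d k + (1 - q) * (W / (1 - q))\<close>\<close>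
    also have "\<dots> \<le> q * (d k)\<^sup>2 + W\<^sup>2 / (1 - q)"
    proof -
      have "q * (d k)\<^sup>2 + W\<^sup>2 / (1 - q) - (q * d k + W)\<^sup>2 = q / (1 - q) * ((1 - q) * d k - W)\<^sup>2"
        using q by (simp add: field_simps power2_eq_square)
      also have "\<dots> \<ge> 0" using q by simp
      finally show ?thesis by simp
    qed
    also have "W\<^sup>2 \<le> T * (\<Sum>r<T. (g (k + r))\<^sup>2)"
      using sum_squared_le_sum_of_squares[of "\<lambda>r. g (k + r)" "{..<T}"]
      by (simp add: W_def mult.commute)
    finally show ?thesis using q by (simp add: divide_right_mono)
  qed
  have shift: "(\<Sum>k\<le>K. \<Sum>r<T. (g (k + r))\<^sup>2) \<le> T * (\<Sum>k<K + T. (g k)\<^sup>2)" for K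
  proof -
    have "(\<Sum>k\<le>K. (g (k + r))\<^sup>2) \<le> (\<Sum>k<K + T. (g k)\<^sup>2)" if "r < T" for r
    proof -
      have "(\<Sum>k\<le>K. (g (k + r))\<^sup>2) = (\<Sum>k\<in>(\<lambda>k. k + r) ` {..K}. (g k)\<^sup>2)"
        by (simp add: sum.reindex)
      also have "\<dots> \<le> (\<Sum>k<K + T. (g k)\<^sup>2)"
        using that by (intro sum_mono2) auto
      finally show ?thesis .
    qed
    then have "(\<Sum>r<T. \<Sum>k\<le>K. (g (k + r))\<^sup>2) \<le> (\<Sum>r<T. \<Sum>k<K + T. (g k)\<^sup>2)"
      by (intro sum_mono) auto
    then show ?thesis by (subst sum.swap) simp
  qed
  define B where "B = T / (1 - q) * T"
  have B: "B \<ge> 0" using q by (simp add: B_def)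
  have bound: "(1 - q) * S K \<le> A + B * (\<Sum>k<K. (g k)\<^sup>2)" for K
  proof (cases "T \<le> K")
    case True
    then obtain K0 where K0: "K = K0 + T" using le_Suc_ex by (metis add.commute)
    have "S K = A + (\<Sum>k\<le>K0. (d (k + T))\<^sup>2)"
    proof -
      have "{..K} = {..<T} \<union> (\<lambda>k. k + T) ` {..K0}"
      proof (intro set_eqI iffI)
        fix t assume "t \<in> {..K}"
        then show "t \<in> {..<T} \<union> (\<lambda>k. k + T) ` {..K0}"
          unfolding K0 by (cases "t < T") (auto intro: image_eqI[of _ _ "t - T"])
      qed (auto simp: K0)
      moreover have "{..<T} \<inter> (\<lambda>k. k + T) ` {..K0} = {}" by auto
      ultimately show ?thesis
        by (simp add: S_def A_def sum.union_disjoint sum.reindex)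
    qed
    also have "(\<Sum>k\<le>K0. (d (k + T))\<^sup>2) \<le>
        (\<Sum>k\<le>K0. q * (d k)\<^sup>2 + T / (1 - q) * (\<Sum>r<T. (g (k + r))\<^sup>2))"
      by (intro sum_mono sq)
    also have "\<dots> = q * S K0 + T / (1 - q) * (\<Sum>k\<le>K0. \<Sum>r<T. (g (k + r))\<^sup>2)"
      by (simp add: sum.distrib sum_distrib_left S_def)
    also have "\<dots> \<le> q * S K + T / (1 - q) * (T * (\<Sum>k<K. (g k)\<^sup>2))"
    proof (intro add_mono mult_left_mono)
      show "S K0 \<le> S K" unfolding S_def K0 by (intro sum_mono2) auto
      show "(\<Sum>k\<le>K0. \<Sum>r<T. (g (k + r))\<^sup>2) \<le> T * (\<Sum>k<K. (g k)\<^sup>2)"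
        using shift[of K0] by (simp add: K0)
    qed (use q in auto)
    finally show ?thesis by (simp add: B_def algebra_simps)
  next
    case False
    then have "S K \<le> A" unfolding S_def A_def by (intro sum_mono2) auto
    moreover have "(1 - q) * S K \<le> S K"
      using q by (intro mult_left_le_one_le) (auto simp: S_def sum_nonneg)
    moreover have "B * (\<Sum>k<K. (g k)\<^sup>2) \<ge> 0" using B by (simp add: sum_nonneg)
    ultimately show ?thesis by linarith
  qed
  have "S K \<le> A / (1 - q) + B / (1 - q) * (\<Sum>k<K. (g k)\<^sup>2)" for K
  proof -
    have "S K \<le> (A + B * (\<Sum>k<K. (g k)\<^sup>2)) / (1 - q)"
      using bound[of K] q by (simp add: pos_le_divide_eq mult.commute)
    then show ?thesis by (simp add: add_divide_distrib)
  qed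
  then show ?thesis
    using B q by (intro exI[of _ "A / (1 - q)"] exI[of _ "B / (1 - q)"]) (auto simp: S_def)
qed

lemma (in mixing_weights) deviation_square_sum:
  fixes x :: "'m \<Rightarrow> nat \<Rightarrow> 'v::real_normed_vector"
  defines "e \<equiv> \<lambda>i k. x i (Suc k) - (\<Sum>j\<in>UNIV. a i j k *\<^sub>R x j k)"
  shows "\<exists>C0. \<exists>C1\<ge>0. \<forall>K. (\<Sum>k\<le>K. (deviation (\<lambda>i. x i k))\<^sup>2)
    \<le> C0 + C1 * (\<Sum>k<K. \<Sum>i\<in>UNIV. (norm (e i k))\<^sup>2)"
proof -
  obtain T q where Tq: "0 \<le> q" "q < 1"
    and rec: "\<And>k. deviation (\<lambda>i. x i (k + T)) \<le> q * deviation (\<lambda>i. x i k)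
      + 2 * (\<Sum>r<T. \<Sum>i\<in>UNIV. norm (e i (k + r)))"
    using deviation_window unfolding e_def by blast
  define g where "g k = 2 * (\<Sum>i\<in>UNIV. norm (e i k))" for k
  obtain C0 C1 where C: "C1 \<ge> 0"
    "\<And>K. (\<Sum>k\<le>K. (deviation (\<lambda>i. x i k))\<^sup>2) \<le> C0 + C1 * (\<Sum>k<K. (g k)\<^sup>2)"
    using square_sum_recursion[OF Tq, where d = "\<lambda>k. deviation (\<lambda>i. x i k)" and g = g and T = T] rec
    by (auto simp: deviation_nonneg g_def sum_distrib_left)
  have g_sq: "(g k)\<^sup>2 \<le> 4 * CARD('m) * (\<Sum>i\<in>UNIV. (norm (e i k))\<^sup>2)" for k
    using sum_squared_le_sum_of_squares[of "\<lambda>i. norm (e i k)" UNIV]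
    by (simp add: g_def power_mult_distrib mult.commute)
  have "(\<Sum>k\<le>K. (deviation (\<lambda>i. x i k))\<^sup>2)
      \<le> C0 + (C1 * (4 * CARD('m))) * (\<Sum>k<K. \<Sum>i\<in>UNIV. (norm (e i k))\<^sup>2)" for K
  proof -
    have "(\<Sum>k<K. (g k)\<^sup>2) \<le> (4 * CARD('m)) * (\<Sum>k<K. \<Sum>i\<in>UNIV. (norm (e i k))\<^sup>2)"
      using sum_mono[of "{..<K}", OF g_sq] by (simp only: sum_distrib_left)
    from mult_left_mono[OF this C(1)] C(2)[of K] show ?thesis by (simp add: mult.assoc)
  qed
  then show ?thesis
    using C(1) by (intro exI[of _ C0] exI[of _ "C1 * (4 * CARD('m))"]) auto
qed

text \<open>Jensen's inequality for each row, then the columns sum to 1.\<close>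
lemma (in mixing_weights) averaging_nonexpansive:
  fixes y :: "'m \<Rightarrow> 'v::real_normed_vector"
  shows "(\<Sum>i\<in>UNIV. (norm ((\<Sum>j\<in>UNIV. a i j k *\<^sub>R y j) - p))\<^sup>2) \<le> (\<Sum>i\<in>UNIV. (norm (y i - p))\<^sup>2)"
proof -
  have "(norm ((\<Sum>j\<in>UNIV. a i j k *\<^sub>R y j) - p))\<^sup>2 \<le> (\<Sum>j\<in>UNIV. a i j k * (norm (y j - p))\<^sup>2)" for i
  proof -
    have "(\<Sum>j\<in>UNIV. a i j k *\<^sub>R y j) - p = (\<Sum>j\<in>UNIV. a i j k *\<^sub>R (y j - p))"
      by (simp add: scaleR_diff_right sum_subtractf row_sum flip: scaleR_sum_left)
    also have "norm \<dots> \<le> (\<Sum>j\<in>UNIV. a i j k * norm (y j - p))"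
      by (rule order_trans[OF norm_sum]) (simp add: weight_nonneg)
    finally have "(norm ((\<Sum>j\<in>UNIV. a i j k *\<^sub>R y j) - p))\<^sup>2 \<le> (\<Sum>j\<in>UNIV. a i j k * norm (y j - p))\<^sup>2"
      by (intro power_mono) auto
    also have "\<dots> \<le> (\<Sum>j\<in>UNIV. a i j k * (norm (y j - p))\<^sup>2)"
      using convex_on_sum[OF _ _ convex_power2, of UNIV "\<lambda>j. a i j k" "\<lambda>j. norm (y j - p)"]
      by (simp add: row_sum weight_nonneg)
    finally show ?thesis .
  qed
  then have "(\<Sum>i\<in>UNIV. (norm ((\<Sum>j\<in>UNIV. a i j k *\<^sub>R y j) - p))\<^sup>2)
      \<le> (\<Sum>i\<in>UNIV. \<Sum>j\<in>UNIV. a i j k * (norm (y j - p))\<^sup>2)"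
    by (intro sum_mono)
  also have "\<dots> = (\<Sum>j\<in>UNIV. (\<Sum>i\<in>UNIV. a i j k) * (norm (y j - p))\<^sup>2)"
    by (subst sum.swap) (simp add: sum_distrib_right)
  finally show ?thesis by (simp add: column_sum)
qed

section \<open>The proximal step\<close>

lemma norm_convex_combination_sq:
  fixes p q :: "'v::real_inner"
  shows "(norm ((1 - t) *\<^sub>R p + t *\<^sub>R q))\<^sup>2
    = (1 - t) * (norm p)\<^sup>2 + t * (norm q)\<^sup>2 - t * (1 - t) * (norm (p - q))\<^sup>2"
  unfolding power2_norm_eq_inner
  by (simp add: inner_simps inner_commute algebra_simps power2_eq_square)

text \<open>
  The proximal objective grows quadratically in the \<open>x\<close>-component away from its minimizer.
  Minimality is tested against the points of the segment to \<open>(y', v')\<close> at parameter \<open>t\<close>. Dividing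
  by \<open>t\<close> leaves the claim with the factor \<open>1 - t\<close> in front of \<open>(norm (y - y'))\<^sup>2\<close>, and \<open>t\<close> tends
  to 0.
\<close>
lemma prox_inequality:
  assumes conv: "convex_on S f" "convex V" "V \<subseteq> S" and c: "c > 0"
    and prox: "(y, v) \<in> prox_minimizers f V c xbar" and other: "(y', v') \<in> V"
  shows "2 * c * (f (y, v) - f (y', v')) + (norm (y - xbar))\<^sup>2 + (norm (y - y'))\<^sup>2
    \<le> (norm (xbar - y'))\<^sup>2"
proof -
  define A where "A = 2 * c * (f (y, v) - f (y', v')) + (norm (y - xbar))\<^sup>2"
  have V: "(y, v) \<in> V" and
    min: "\<And>w w'. (w, w') \<in> V \<Longrightarrow> f (y, v) + 1 / (2 * c) * (norm (xbar - y))\<^sup>2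
       \<le> f (w, w') + 1 / (2 * c) * (norm (xbar - w))\<^sup>2"
    using prox by (auto simp: prox_minimizers_def is_arg_min_linorder)
  have bound: "A + (1 - t) * (norm (y - y'))\<^sup>2 \<le> (norm (xbar - y'))\<^sup>2" if t: "0 < t" "t < 1" for t
  proof -
    define w where "w = (1 - t) *\<^sub>R y + t *\<^sub>R y'"
    define w' where "w' = (1 - t) *\<^sub>R v + t *\<^sub>R v'"
    have w: "(w, w') = (1 - t) *\<^sub>R (y, v) + t *\<^sub>R (y', v')"
      by (simp add: w_def w'_def)
    have "(w, w') \<in> V"
      unfolding w using convexD_alt[OF conv(2) V other] t by simp
    then have 1: "f (y, v) + 1 / (2 * c) * (norm (xbar - y))\<^sup>2
        \<le> f (w, w') + 1 / (2 * c) * (norm (xbar - w))\<^sup>2" by (rule min)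
    have 2: "f (w, w') \<le> (1 - t) * f (y, v) + t * f (y', v')"
      unfolding w using convex_onD[OF conv(1), of t "(y, v)" "(y', v')"] t V other conv(3) by auto
    have "xbar - w = (1 - t) *\<^sub>R (xbar - y) + t *\<^sub>R (xbar - y')"
      by (simp add: w_def algebra_simps)
    then have 3: "(norm (xbar - w))\<^sup>2 = (1 - t) * (norm (xbar - y))\<^sup>2 + t * (norm (xbar - y'))\<^sup>2
        - t * (1 - t) * (norm (y - y'))\<^sup>2"
      by (simp add: norm_convex_combination_sq norm_minus_commute)
    have "2 * c * f (y, v) + (norm (xbar - y))\<^sup>2 \<le> 2 * c * f (w, w') + (norm (xbar - w))\<^sup>2"
      using mult_left_mono[OF 1, of "2 * c"] c by (simp add: algebra_simps)
    also have "\<dots> \<le> 2 * c * ((1 - t) * f (y, v) + t * f (y', v')) + (norm (xbar - w))\<^sup>2"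
      using 2 c by simp
    finally have "t * (A + (1 - t) * (norm (y - y'))\<^sup>2) \<le> t * (norm (xbar - y'))\<^sup>2"
      unfolding 3 A_def norm_minus_commute[of y xbar] by (simp add: algebra_simps)
    then show ?thesis using t by simp
  qed
  have "((\<lambda>t. A + (1 - t) * (norm (y - y'))\<^sup>2) \<longlongrightarrow> A + (1 - 0) * (norm (y - y'))\<^sup>2) (at_right 0)"
    by (intro tendsto_intros)
  then have "A + (1 - 0) * (norm (y - y'))\<^sup>2 \<le> (norm (xbar - y'))\<^sup>2"
    by (rule tendsto_upperbound) (auto intro!: eventually_at_rightI[of 0 1] bound)
  then show ?thesis by (simp add: A_def)
qed

section \<open>Lipschitz dependence on the slice\<close>

text \<open>
  Since \<open>A\<close> and \<open>B\<close> are bounded, their distances from a common point differ by a bounded amount.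
  So the supremum in \<open>pompeiu_hausdorff\<close> is that of a bounded set of reals, and hence an upper bound
  of this set.
\<close>
lemma infdist_le_pompeiu_hausdorff:
  fixes A B :: "'a::metric_space set"
  assumes "bounded A" "bounded B" "A \<noteq> {}" "B \<noteq> {}" "v \<in> A" "v \<in> E"
  shows "infdist v B \<le> pompeiu_hausdorff E A B"
proof -
  obtain R where R: "\<And>p q. p \<in> A \<union> B \<Longrightarrow> q \<in> A \<union> B \<Longrightarrow> dist p q \<le> R"
    using assms(1,2) bounded_two_points[of "A \<union> B"] by auto
  have le: "infdist w P \<le> infdist w Q + R"
    if "P \<subseteq> A \<union> B" "Q \<subseteq> A \<union> B" "P \<noteq> {}" "Q \<noteq> {}" for w P Q
  proof -
    obtain p where p: "p \<in> P" using \<open>P \<noteq> {}\<close> by auto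
    have "infdist w P - R \<le> dist w q" if "q \<in> Q" for q
    proof -
      have "infdist w P \<le> dist w p" by (rule infdist_le[OF p])
      also have "\<dots> \<le> dist w q + dist q p" by (rule dist_triangle)
      also have "dist q p \<le> R" using R p that \<open>P \<subseteq> _\<close> \<open>Q \<subseteq> _\<close> by blast
      finally show ?thesis by simp
    qed
    then have "infdist w P - R \<le> infdist w Q"
      using that(4) by (auto simp: infdist_notempty intro: cINF_greatest)
    then show ?thesis by simp
  qed
  have "bdd_above ((\<lambda>u. \<bar>infdist u A - infdist u B\<bar>) ` E)"
  proof (rule bdd_aboveI2[of _ _ R])
    fix w
    show "\<bar>infdist w A - infdist w B\<bar> \<le> R"
      using le[of A B w] le[of B A w] assms(3,4) by (auto simp: abs_le_iff)
  qed
  then have "\<bar>infdist v A - infdist v B\<bar> \<le> pompeiu_hausdorff E A B"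
    unfolding pompeiu_hausdorff_def by (rule cSUP_upper[OF assms(6)])
  then show ?thesis using assms(5) by simp
qed

text \<open>
  When the slices are compact and \<open>f\<close> is continuous, this says that the value function
  \<open>y \<mapsto> min {f (y, v) | v. (y, v) \<in> V}\<close> is \<open>G\<close>-Lipschitz on its domain. Speaking of points of \<open>V\<close>
  instead of minima provides local variables to accompany a modified \<open>x\<close>-component.
\<close>
definition slice_lipschitz ::
  "real \<Rightarrow> ('a::real_normed_vector \<times> 'b \<Rightarrow> real) \<Rightarrow> ('a \<times> 'b) set \<Rightarrow> bool" where
  "slice_lipschitz G f V \<longleftrightarrow> (\<forall>y v y'. (y, v) \<in> V \<longrightarrow> y' \<in> slice_domain V \<longrightarrow>
    (\<exists>v'. (y', v') \<in> V \<and> f (y', v') \<le> f (y, v) + G * norm (y - y')))"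

lemma slice_lipschitzD:
  assumes "slice_lipschitz G f V" "(y, v) \<in> V" "y' \<in> slice_domain V"
  shows "\<exists>v'. (y', v') \<in> V \<and> f (y', v') \<le> f (y, v) + G * norm (y - y')"
  using assms unfolding slice_lipschitz_def by blast

lemma slice_lipschitz_mono:
  assumes "slice_lipschitz G f V" "G \<le> G'"
  shows "slice_lipschitz G' f V"
  unfolding slice_lipschitz_def
proof (intro allI impI)
  fix y v y' assume "(y, v) \<in> V" "y' \<in> slice_domain V"
  from slice_lipschitzD[OF assms(1) this]
  obtain v' where v': "(y', v') \<in> V" "f (y', v') \<le> f (y, v) + G * norm (y - y')" by blast
  have "G * norm (y - y') \<le> G' * norm (y - y')"
    using assms(2) by (rule mult_right_mono) simp
  with v' show "\<exists>v'. (y', v') \<in> V \<and> f (y', v') \<le> f (y, v) + G' * norm (y - y')"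
    by (intro exI[of _ v']) simp
qed

text \<open>
  The local variable \<open>v\<close> is replaced by its nearest point in the slice over \<open>y'\<close>. The pair then
  moves by at most \<open>(1 + L) * norm (y - y')\<close>.
\<close>
lemma slice_lipschitz_of_hausdorff_lipschitz:
  fixes V :: "('a::{heine_borel,real_normed_vector} \<times> 'b::{heine_borel,real_normed_vector}) set"
  assumes V: "V \<subseteq> UNIV \<times> E" "compact V"
    and lip: "M-lipschitz_on (UNIV \<times> E) f"
    and L: "\<forall>y\<in>slice_domain V. \<forall>y'\<in>slice_domain V.
      pompeiu_hausdorff E (slice V y) (slice V y') \<le> L * norm (y - y')"
  shows "slice_lipschitz (M * (1 + L)) f V"
  unfolding slice_lipschitz_def
proof (intro allI impI)
  have M: "M \<ge> 0" using lip by (rule lipschitz_on_nonneg)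
  fix y v y'
  assume v: "(y, v) \<in> V" and y': "y' \<in> slice_domain V"
  have slice: "compact (slice V w)" for w
  proof -
    have "slice V w = snd ` (V \<inter> {w} \<times> UNIV)"
      by (force simp: slice_def)
    moreover have "closed ({w} \<times> (UNIV :: 'b set))" by (intro closed_Times) auto
    ultimately show ?thesis
      using V(2) by (auto intro!: compact_continuous_image continuous_intros compact_Int_closed)
  qed
  have ne: "slice V y \<noteq> {}" "slice V y' \<noteq> {}" and vy: "v \<in> slice V y" and y: "y \<in> slice_domain V"
    using v y' by (auto simp: slice_def slice_domain_def)
  have "infdist v (slice V y') \<le> pompeiu_hausdorff E (slice V y) (slice V y')"
    using slice ne vy v V(1) by (intro infdist_le_pompeiu_hausdorff compact_imp_bounded) auto
  also have "\<dots> \<le> L * norm (y - y')" using L y y' by blast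
  finally have d: "infdist v (slice V y') \<le> L * norm (y - y')" .
  obtain v' where v': "v' \<in> slice V y'" "infdist v (slice V y') = dist v v'"
    using infdist_attains_inf[OF compact_imp_closed[OF slice] ne(2)] by blast
  have V': "(y', v') \<in> V" using v'(1) by (simp add: slice_def)
  have "f (y', v') - f (y, v) \<le> M * dist (y, v) (y', v')"
  proof -
    have "v \<in> E" "v' \<in> E" using v V' V(1) by auto
    then show ?thesis
      using lipschitz_onD[OF lip, of "(y, v)" "(y', v')"] by (simp add: dist_real_def)
  qed
  also have "dist (y, v) (y', v') \<le> dist y y' + dist v v'"
    by (simp add: dist_Pair_Pair sqrt_sum_squares_le_sum)
  also have "\<dots> \<le> (1 + L) * norm (y - y')"
    using d v'(2) by (simp add: dist_norm algebra_simps)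
  finally have "f (y', v') \<le> f (y, v) + M * (1 + L) * norm (y - y')"
    using M by (simp add: mult_left_mono mult.assoc)
  then show "\<exists>v'. (y', v') \<in> V \<and> f (y', v') \<le> f (y, v) + M * (1 + L) * norm (y - y')"
    using V' by blast
qed

section \<open>A common point of the domains near the mean\<close>

text \<open>
  The mean \<open>w0\<close> of the \<open>y i\<close> may lie outside every \<open>X i\<close>, but its distance to each is at most
  \<open>\<epsilon> = deviation y\<close>. Pull it towards \<open>p\<close> by the fraction \<open>t = \<epsilon> / (\<epsilon> + \<rho>)\<close>. The result is also
  \<open>(1 - t) * y i + t * p'\<close>, where \<open>p'\<close> is \<open>p\<close> displaced by \<open>(\<rho> / \<epsilon>) * (w0 - y i)\<close>. This
  displacement has norm at most \<open>\<rho>\<close>, so \<open>p'\<close> lies in \<open>X i\<close>, and convexity applies. The point does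
  not depend on \<open>i\<close>.
\<close>
lemma common_point_near_mean:
  fixes y :: "'m::finite \<Rightarrow> 'v::real_normed_vector"
  assumes X: "\<And>i. convex (X i)" "\<And>i. cball p \<rho> \<subseteq> X i" "\<And>i. y i \<in> X i" and \<rho>: "\<rho> > 0"
  shows "\<exists>w. (\<forall>i. w \<in> X i) \<and> norm (w - mean y) \<le> deviation y / \<rho> * norm (p - mean y)"
proof (cases "deviation y = 0")
  case True
  then have "mean y = y i" for i
    using norm_diff_mean_le_deviation[of y i] by simp
  then have "\<forall>i. mean y \<in> X i" using X(3) by metis
  then show ?thesis by (intro exI[of _ "mean y"]) (simp add: True)
next
  case False
  define \<epsilon> where "\<epsilon> = deviation y"
  have \<epsilon>: "\<epsilon> > 0" using False deviation_nonneg[of y] by (simp add: \<epsilon>_def)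
  define t where "t = \<epsilon> / (\<epsilon> + \<rho>)"
  have t: "0 \<le> t" "t \<le> 1" "1 - t = \<rho> / (\<epsilon> + \<rho>)" "t \<le> \<epsilon> / \<rho>"
    using \<epsilon> \<rho> by (auto simp: t_def field_simps)
  define w where "w = (1 - t) *\<^sub>R mean y + t *\<^sub>R p"
  have "w \<in> X i" for i
  proof -
    define p' where "p' = p + (\<rho> / \<epsilon>) *\<^sub>R (mean y - y i)"
    have "norm (mean y - y i) \<le> \<epsilon>"
      using norm_diff_mean_le_deviation[of y i] by (simp add: \<epsilon>_def norm_minus_commute)
    then have "(\<rho> / \<epsilon>) * norm (mean y - y i) \<le> \<rho>"
      using mult_left_mono[of "norm (mean y - y i)" \<epsilon> "\<rho> / \<epsilon>"] \<epsilon> \<rho> by simp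
    then have "p' \<in> cball p \<rho>"
      using \<epsilon> \<rho> by (simp add: p'_def dist_norm)
    then have "(1 - t) *\<^sub>R y i + t *\<^sub>R p' \<in> X i"
      using X(2) convexD_alt[OF X(1) X(3)] t by blast
    moreover have "(1 - t) *\<^sub>R y i + t *\<^sub>R p' = w"
    proof -
      have "t * (\<rho> / \<epsilon>) = 1 - t" unfolding t(3) using \<epsilon> by (simp add: t_def)
      then show ?thesis by (simp add: w_def p'_def scaleR_add_right scaleR_diff_right)
    qed
    ultimately show ?thesis by simp
  qed
  moreover have "norm (w - mean y) \<le> \<epsilon> / \<rho> * norm (p - mean y)"
  proof -
    have "w - mean y = t *\<^sub>R (p - mean y)"
      by (simp add: w_def algebra_simps)
    then show ?thesis using mult_right_mono[OF t(4), of "norm (p - mean y)"] t(1) by simp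
  qed
  ultimately show ?thesis unfolding \<epsilon>_def by blast
qed

section \<open>Real sequences\<close>

text \<open>If \<open>h\<close> stayed above some \<open>e > 0\<close>, then \<open>c \<le> c * h / e\<close> would be summable.\<close>
lemma subseq_to_zero_of_summable:
  fixes c h :: "nat \<Rightarrow> real"
  assumes c: "\<And>k. c k > 0" "filterlim (\<lambda>K. \<Sum>k<K. c k) at_top sequentially"
    and h: "\<And>k. h k \<ge> 0" "summable (\<lambda>k. c k * h k)"
  shows "\<exists>r. strict_mono r \<and> (\<lambda>n. h (r n)) \<longlonglongrightarrow> 0"
proof -
  have small: "\<exists>n>N. h n < e" if e: "e > 0" for e N
  proof (rule ccontr)
    assume "\<not> ?thesis"
    then have "h n \<ge> e" if "n \<ge> Suc N" for n
      using that by (metis Suc_le_lessD linorder_not_less)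
    then have "norm (c n) \<le> c n * h n / e" if "n \<ge> Suc N" for n
      using that e c(1)[of n] by (simp add: field_simps)
    then have "summable c"
      using summable_comparison_test'[OF summable_divide[OF h(2), of e]] by blast
    then have "(\<lambda>K. \<Sum>k<K. c k) \<longlonglongrightarrow> suminf c" by (rule summable_LIMSEQ)
    then show False
      using not_tendsto_and_filterlim_at_infinity[OF sequentially_bot]
        filterlim_at_top_imp_at_infinity[OF c(2)] by blast
  qed
  have "\<exists>r. \<forall>n. h (r n) < inverse (real (Suc n)) \<and> r n < r (Suc n)"
  proof (rule dependent_nat_choice)
    show "\<exists>n. h n < inverse (real (Suc 0))" using small[of 1 0] by auto
    show "\<exists>n. h n < inverse (real (Suc (Suc m))) \<and> N < n" for N m
      using small[of "inverse (real (Suc (Suc m)))" N] by auto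
  qed
  then obtain r where r: "\<And>n. h (r n) < inverse (real (Suc n))" "strict_mono r"
    by (auto simp: strict_mono_Suc_iff)
  have "(\<lambda>n. h (r n)) \<longlonglongrightarrow> 0"
    by (rule tendsto_sandwich[OF _ _ tendsto_const LIMSEQ_inverse_real_of_nat])
       (simp_all only: h(1) less_imp_le[OF r(1)] always_eventually simp_thms)
  with r(2) show ?thesis by blast
qed

text \<open>Subtracting the partial sums of \<open>b\<close> turns \<open>s\<close> into a decreasing sequence bounded below.\<close>
lemma convergent_of_almost_decreasing:
  fixes s b :: "nat \<Rightarrow> real"
  assumes "\<And>k. s k \<ge> 0" "\<And>k. b k \<ge> 0" "\<And>k. s (Suc k) \<le> s k + b k" "summable b"
  shows "convergent s"
proof -
  define t where "t k = s k - (\<Sum>r<k. b r)" for k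
  have "decseq t" using assms(3) by (intro decseq_SucI) (simp add: t_def algebra_simps)
  moreover have "- suminf b \<le> t k" for k
    using assms(1)[of k] sum_le_suminf[OF assms(4), of "{..<k}"] assms(2) by (simp add: t_def)
  ultimately obtain l where "t \<longlonglongrightarrow> l"
    using decseq_convergent by blast
  from tendsto_add[OF this summable_LIMSEQ[OF assms(4)]] show ?thesis
    by (auto simp: t_def convergent_def)
qed

text \<open>
  The two inequalities are coupled: \<open>descent\<close> bounds the sum of \<open>E\<close> in terms of \<open>d\<close>, and \<open>dev\<close>
  bounds \<open>d\<close> in terms of the sum of \<open>E\<close>. The loop closes because Young's inequality makes the
  coefficient of \<open>d\<^sup>2\<close> as small as desired, with square-summable \<open>c\<close> paying for it.
\<close>
lemma descent_summable:
  fixes s E w d c :: "nat \<Rightarrow> real"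
  assumes nonneg: "\<And>k. s k \<ge> 0" "\<And>k. E k \<ge> 0" "\<And>k. w k \<ge> 0"
    and descent: "\<And>k. s (Suc k) + E k + w k \<le> s k + H * (c k * d (Suc k))"
    and dev: "C1 \<ge> 0" "\<And>K. (\<Sum>k\<le>K. (d k)\<^sup>2) \<le> C0 + C1 * (\<Sum>k<K. E k)"
    and c: "summable (\<lambda>k. (c k)\<^sup>2)"
  shows "summable w" "summable (\<lambda>k. (d k)\<^sup>2)"
proof -
  \<comment> \<open>so small that \<open>\<beta> * C1 * sum E\<close> uses up at most half of \<open>sum E\<close>\<close>
  define \<beta> where "\<beta> = 1 / (2 * (C1 + 1))"
  have \<beta>: "\<beta> > 0" "\<beta> * C1 \<le> 1 / 2" using dev(1) by (auto simp: \<beta>_def field_simps)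
  define Q where "Q = H\<^sup>2 / (4 * \<beta>) * (\<Sum>k. (c k)\<^sup>2)"
  have young: "H * (c k * d (Suc k)) \<le> \<beta> * (d (Suc k))\<^sup>2 + H\<^sup>2 / (4 * \<beta>) * (c k)\<^sup>2" for k
  proof -
    have "\<beta> * (d (Suc k))\<^sup>2 + H\<^sup>2 / (4 * \<beta>) * (c k)\<^sup>2 - H * (c k * d (Suc k))
        = \<beta> * (d (Suc k) - H * c k / (2 * \<beta>))\<^sup>2"
      using \<beta>(1) by (simp add: field_simps power2_eq_square)
    also have "\<dots> \<ge> 0" using \<beta>(1) by simp
    finally show ?thesis by simp
  qed
  have total: "(\<Sum>k<K. E k) / 2 + (\<Sum>k<K. w k) \<le> s 0 + \<beta> * C0 + Q" for K
  proof -
    have "s K + (\<Sum>k<K. E k) + (\<Sum>k<K. w k) \<le>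
        s 0 + (\<Sum>k<K. \<beta> * (d (Suc k))\<^sup>2 + H\<^sup>2 / (4 * \<beta>) * (c k)\<^sup>2)"
    proof (induction K)
      case (Suc K)
      then show ?case using descent[of K] young[of K] by simp
    qed simp
    also have "\<dots> = s 0 + \<beta> * (\<Sum>k<K. (d (Suc k))\<^sup>2) + H\<^sup>2 / (4 * \<beta>) * (\<Sum>k<K. (c k)\<^sup>2)"
      by (simp add: sum.distrib sum_distrib_left)
    finally have 1: "s K + (\<Sum>k<K. E k) + (\<Sum>k<K. w k) \<le>
        s 0 + \<beta> * (\<Sum>k<K. (d (Suc k))\<^sup>2) + H\<^sup>2 / (4 * \<beta>) * (\<Sum>k<K. (c k)\<^sup>2)" .
    have 2: "H\<^sup>2 / (4 * \<beta>) * (\<Sum>k<K. (c k)\<^sup>2) \<le> Q"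
      unfolding Q_def using \<beta>(1) by (intro mult_left_mono sum_le_suminf c) auto
    have "(\<Sum>k<K. (d (Suc k))\<^sup>2) \<le> (\<Sum>k\<le>K. (d k)\<^sup>2)"
      by (simp add: sum.atMost_shift)
    also note dev(2)[of K]
    finally have "\<beta> * (\<Sum>k<K. (d (Suc k))\<^sup>2) \<le> \<beta> * (C0 + C1 * (\<Sum>k<K. E k))"
      using \<beta>(1) by (intro mult_left_mono) auto
    also have "\<dots> = \<beta> * C0 + \<beta> * C1 * (\<Sum>k<K. E k)"
      by (simp add: distrib_left mult.assoc)
    also have "\<beta> * C1 * (\<Sum>k<K. E k) \<le> 1 / 2 * (\<Sum>k<K. E k)"
      using \<beta>(2) by (intro mult_right_mono sum_nonneg nonneg) auto
    finally show ?thesis using 1 2 nonneg(1)[of K] by simp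
  qed
  show "summable w"
  proof (rule summableI_nonneg_bounded)
    show "(\<Sum>k<K. w k) \<le> s 0 + \<beta> * C0 + Q" for K
      using total[of K] sum_nonneg[of "{..<K}" E] nonneg(2) by auto
  qed (rule nonneg)
  have E: "(\<Sum>k<K. E k) \<le> 2 * (s 0 + \<beta> * C0 + Q)" for K
    using total[of K] sum_nonneg[of "{..<K}" w] nonneg(3) by auto
  have "(\<Sum>k<K. (d k)\<^sup>2) \<le> C0 + C1 * (2 * (s 0 + \<beta> * C0 + Q))" for K
  proof -
    have "(\<Sum>k<K. (d k)\<^sup>2) \<le> (\<Sum>k\<le>K. (d k)\<^sup>2)" by (intro sum_mono2) auto
    also note dev(2)[of K]
    also have "C1 * (\<Sum>k<K. E k) \<le> C1 * (2 * (s 0 + \<beta> * C0 + Q))"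
      using E dev(1) by (intro mult_left_mono)
    finally show ?thesis by simp
  qed
  then show "summable (\<lambda>k. (d k)\<^sup>2)"
    by (rule summableI_nonneg_bounded[rotated]) simp
qed

section \<open>The optimization problem\<close>

definition objective ::
  "('m::finite \<Rightarrow> (real ^ 'n) \<times> (real ^ 'p) \<Rightarrow> real) \<Rightarrow> (real ^ 'n) \<times> ((real ^ 'p) ^ 'm) \<Rightarrow> real" where
  "objective f z = (\<Sum>i\<in>UNIV. f i (fst z, snd z $ i))"

lemma is_minimizer_iff:
  "is_minimizer f V x u \<longleftrightarrow> (x, u) \<in> feasible_set V \<and>
     (\<forall>z\<in>feasible_set V. objective f (x, u) \<le> objective f z)"
proof -
  have "(\<lambda>(x, u). \<Sum>i\<in>UNIV. f i (x, u $ i)) = objective f"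
    by (auto simp: objective_def fun_eq_iff)
  then show ?thesis by (auto simp: is_minimizer_def is_arg_min_linorder)
qed

lemma mem_feasible_set: "z \<in> feasible_set V \<longleftrightarrow> (\<forall>i. (fst z, snd z $ i) \<in> V i)"
  by (cases z) (simp add: feasible_set_def)

lemma compact_feasible_set:
  fixes V :: "'m::finite \<Rightarrow> ((real ^ 'n::finite) \<times> (real ^ 'p::finite)) set"
  assumes V: "\<And>i. compact (V i)"
  shows "compact (feasible_set V)"
proof -
  have "feasible_set V = (\<Inter>i. (\<lambda>z. (fst z, snd z $ i)) -` V i)"
    by (auto simp: mem_feasible_set)
  moreover have "closed ((\<lambda>z :: (real ^ 'n) \<times> ((real ^ 'p) ^ 'm). (fst z, snd z $ i)) -` V i)" for i
    using compact_imp_closed[OF V] by (intro closed_vimage continuous_intros)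
  ultimately have cl: "closed (feasible_set V)" by auto
  have "\<exists>b. \<forall>z\<in>V i. norm z \<le> b" for i
    using compact_imp_bounded[OF V] by (auto simp: bounded_iff)
  then obtain b where b: "\<And>i z. z \<in> V i \<Longrightarrow> norm z \<le> b i" by metis
  have "norm z \<le> b undefined + (\<Sum>i\<in>UNIV. b i)" if z: "z \<in> feasible_set V" for z
  proof -
    have zi: "norm (fst z, snd z $ i) \<le> b i" for i
      using z b by (auto simp: mem_feasible_set)
    have "norm z \<le> norm (fst z) + norm (snd z)"
      by (metis norm_Pair_le prod.collapse)
    also have "norm (snd z) \<le> (\<Sum>i\<in>UNIV. norm (snd z $ i))"
      unfolding norm_vec_def by (rule L2_set_le_sum) simp
    also have "\<dots> \<le> (\<Sum>i\<in>UNIV. b i)"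
      by (intro sum_mono order_trans[OF norm_snd_le zi])
    also have "norm (fst z) \<le> b undefined"
      using order_trans[OF norm_fst_le zi] .
    finally show ?thesis by simp
  qed
  then have "bounded (feasible_set V)" unfolding bounded_iff by blast
  with cl show ?thesis using compact_eq_bounded_closed by blast
qed

lemma continuous_on_objective:
  fixes V :: "'m::finite \<Rightarrow> ((real ^ 'n::finite) \<times> (real ^ 'p::finite)) set"
  assumes "\<And>i. continuous_on (V i) (f i)"
  shows "continuous_on (feasible_set V) (objective f)"
  unfolding objective_def
proof (intro continuous_on_sum)
  fix i
  show "continuous_on (feasible_set V) (\<lambda>z. f i (fst z, snd z $ i))"
    by (rule continuous_on_compose2[OF assms[of i], of _ "\<lambda>z. (fst z, snd z $ i)"])
       (auto intro!: continuous_intros simp: mem_feasible_set)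
qed

lemma minimizer_exists:
  fixes V :: "'m::finite \<Rightarrow> ((real ^ 'n::finite) \<times> (real ^ 'p::finite)) set"
  assumes "\<And>i. compact (V i)" "\<And>i. continuous_on (V i) (f i)" "feasible_set V \<noteq> {}"
  shows "\<exists>x u. is_minimizer f V x u"
  using continuous_attains_inf[OF compact_feasible_set[OF assms(1)] assms(3)
      continuous_on_objective[OF assms(2)]]
  by (auto simp: is_minimizer_iff)

text \<open>
  Although each agent respects only its own constraint, the iterates are close to a feasible point
  of the joint problem, with a cost that is not much larger. In units of \<open>deviation y\<close>, the first
  summand of \<open>\<kappa>\<close> bounds the distance from \<open>y i\<close> to the mean, and the second the distance from the
  mean to the common point.
\<close>
lemma feasible_point_near:
  fixes V :: "'m::finite \<Rightarrow> ((real ^ 'n::finite) \<times> (real ^ 'p::finite)) set"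
    and G \<rho> B \<kappa> :: real
  assumes V: "\<And>i. convex (V i)" "\<And>i. cball p \<rho> \<subseteq> slice_domain (V i)" and \<rho>: "\<rho> > 0"
    and G: "G \<ge> 0" "\<And>i. slice_lipschitz G (f i) (V i)"
    and y: "\<And>i. (y i, v i) \<in> V i" "\<And>i. norm (y i) \<le> B"
  defines "\<kappa> \<equiv> 1 + (norm p + B) / \<rho>"
  shows "\<exists>z\<in>feasible_set V. (\<forall>i. norm (fst z - y i) \<le> \<kappa> * deviation y) \<and>
    objective f z \<le> (\<Sum>i\<in>UNIV. f i (y i, v i)) + CARD('m) * G * \<kappa> * deviation y"
proof -
  have dom: "slice_domain (V i) = fst ` V i" for i
    by (force simp: slice_domain_def)
  obtain w where w: "\<And>i. w \<in> slice_domain (V i)"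
    "norm (w - mean y) \<le> deviation y / \<rho> * norm (p - mean y)"
  proof (atomize_elim, rule exE[OF common_point_near_mean[of "\<lambda>i. slice_domain (V i)" p \<rho> y]])
    show "convex (slice_domain (V i))" for i
      unfolding dom by (intro convex_linear_image[OF _ V(1)] linear_fst)
    show "y i \<in> slice_domain (V i)" for i
      using y(1) by (auto simp: slice_domain_def)
  qed (use V(2) \<rho> in auto)
  have "norm (mean y) \<le> B"
  proof -
    have "norm (\<Sum>i\<in>UNIV. y i) \<le> (\<Sum>i\<in>(UNIV::'m set). B)"
      by (intro order_trans[OF norm_sum] sum_mono y(2))
    then show ?thesis by (simp add: mean_def field_simps)
  qed
  then have "norm (p - mean y) \<le> norm p + B"
    using norm_triangle_ineq4[of p "mean y"] by linarith
  from mult_left_mono[OF this, of "deviation y / \<rho>"]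
  have "norm (w - mean y) \<le> deviation y * ((norm p + B) / \<rho>)"
    using w(2) \<rho> deviation_nonneg[of y] by simp
  then have near: "norm (w - y i) \<le> \<kappa> * deviation y" for i
    using norm_diff_mean_le_deviation[of y i] norm_triangle_ineq4[of "w - mean y" "y i - mean y"]
    by (simp add: \<kappa>_def algebra_simps)
  obtain v' where v': "\<And>i. (w, v' i) \<in> V i"
    "\<And>i. f i (w, v' i) \<le> f i (y i, v i) + G * norm (y i - w)"
    using slice_lipschitzD[OF G(2) y(1) w(1)] by metis
  have "f i (w, v' i) \<le> f i (y i, v i) + G * \<kappa> * deviation y" for i
    using v'(2)[of i] mult_left_mono[OF near G(1), of i] by (simp add: norm_minus_commute)
  then have "objective f (w, \<chi> i. v' i) \<le> (\<Sum>i\<in>UNIV. f i (y i, v i) + G * \<kappa> * deviation y)"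
    unfolding objective_def by (intro sum_mono) simp
  then have "objective f (w, \<chi> i. v' i) \<le>
      (\<Sum>i\<in>UNIV. f i (y i, v i)) + CARD('m) * G * \<kappa> * deviation y"
    by (simp add: sum.distrib mult.assoc)
  moreover have "(w, \<chi> i. v' i) \<in> feasible_set V" using v'(1) by (simp add: mem_feasible_set)
  ultimately show ?thesis using near by (intro bexI[of _ "(w, \<chi> i. v' i)"]) auto
qed

text \<open>Only the \<open>x\<close>-component of an interior point is varied; its local variables stay fixed.\<close>
lemma common_ball_of_interior:
  fixes V :: "'m::finite \<Rightarrow> ((real ^ 'n::finite) \<times> (real ^ 'p::finite)) set"
  assumes "(top_of_set (joint_space D)) interior_of (feasible_set V) \<noteq> {}"
  shows "\<exists>p \<rho>. \<rho> > 0 \<and> (\<forall>i. cball p \<rho> \<subseteq> slice_domain (V i))"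
proof -
  obtain p u T where T: "openin (top_of_set (joint_space D)) T" "T \<subseteq> feasible_set V" "(p, u) \<in> T"
    using assms by (auto simp: interior_of_def)
  obtain W where W: "open W" "T = joint_space D \<inter> W"
    using T(1) by (auto simp: openin_open)
  obtain \<rho> where \<rho>: "\<rho> > 0" "cball (p, u) \<rho> \<subseteq> W"
    using W T(3) open_contains_cball by blast
  have "cball p \<rho> \<subseteq> slice_domain (V i)" for i
  proof
    fix q assume "q \<in> cball p \<rho>"
    then have "(q, u) \<in> W" using \<rho>(2) by (auto simp: dist_Pair_Pair)
    moreover have "(q, u) \<in> joint_space D" using T(3) W(2) by (auto simp: joint_space_def)
    ultimately have "(q, u) \<in> feasible_set V" using W(2) T(2) by auto
    then show "q \<in> slice_domain (V i)" by (auto simp: feasible_set_def slice_domain_def)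
  qed
  then show ?thesis using \<rho>(1) by blast
qed

section \<open>Runs of the algorithm\<close>

lemma run_step_prox:
  assumes "algorithm_run f V c a tb x u"
  shows "(x i (Suc k), u i (Suc k)) \<in>
    prox_minimizers (f i) (V i) (c k) (\<Sum>j\<in>UNIV. a i j k *\<^sub>R x j k)"
  using assms unfolding algorithm_run_def Let_def by blast

text \<open>
  The proximal inequality of every agent against the same feasible point is summed over the agents.
  Its right side involves the averages; passing from them to the previous iterates loses nothing.
\<close>
lemma (in mixing_weights) one_step_descent:
  fixes V :: "'m \<Rightarrow> ((real ^ 'n::finite) \<times> (real ^ 'p::finite)) set"
  assumes "\<And>i. convex_on (S i) (f i)" "\<And>i. convex (V i)" "\<And>i. V i \<subseteq> S i" "c k > 0"
    and run: "algorithm_run f V c a tb x u" and z: "z \<in> feasible_set V"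
  shows "(\<Sum>i\<in>UNIV. (norm (x i (Suc k) - fst z))\<^sup>2)
    + (\<Sum>i\<in>UNIV. (norm (x i (Suc k) - (\<Sum>j\<in>UNIV. a i j k *\<^sub>R x j k)))\<^sup>2)
    + 2 * c k * ((\<Sum>i\<in>UNIV. f i (x i (Suc k), u i (Suc k))) - objective f z)
    \<le> (\<Sum>i\<in>UNIV. (norm (x i k - fst z))\<^sup>2)"
proof -
  define xb where "xb i = (\<Sum>j\<in>UNIV. a i j k *\<^sub>R x j k)" for i
  have step: "2 * c k * (f i (x i (Suc k), u i (Suc k)) - f i (fst z, snd z $ i))
      + (norm (x i (Suc k) - xb i))\<^sup>2 + (norm (x i (Suc k) - fst z))\<^sup>2
      \<le> (norm (xb i - fst z))\<^sup>2" for i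
    using prox_inequality[OF assms(1-4) run_step_prox[OF run], of "fst z" "snd z $ i"] z
    by (simp add: xb_def mem_feasible_set)
  have "(\<Sum>i\<in>UNIV. 2 * c k * (f i (x i (Suc k), u i (Suc k)) - f i (fst z, snd z $ i))
      + (norm (x i (Suc k) - xb i))\<^sup>2 + (norm (x i (Suc k) - fst z))\<^sup>2)
      \<le> (\<Sum>i\<in>UNIV. (norm (xb i - fst z))\<^sup>2)"
    by (intro sum_mono step)
  then have "(\<Sum>i\<in>UNIV. (norm (x i (Suc k) - fst z))\<^sup>2) + (\<Sum>i\<in>UNIV. (norm (x i (Suc k) - xb i))\<^sup>2)
    + 2 * c k * ((\<Sum>i\<in>UNIV. f i (x i (Suc k), u i (Suc k))) - objective f z)
    \<le> (\<Sum>i\<in>UNIV. (norm (xb i - fst z))\<^sup>2)"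
    by (simp add: sum.distrib sum_subtractf objective_def flip: sum_distrib_left)
  also have "\<dots> \<le> (\<Sum>i\<in>UNIV. (norm (x i k - fst z))\<^sup>2)"
    unfolding xb_def by (rule averaging_nonexpansive)
  finally show ?thesis by (simp add: xb_def)
qed

lemma run_in_V:
  assumes "algorithm_run f V c a tb x u"
  shows "(x i k, u i k) \<in> V i"
proof (cases k)
  case 0
  then show ?thesis using assms by (auto simp: algorithm_run_def)
next
  case (Suc k')
  then show ?thesis
    using run_step_prox[OF assms, of i k'] by (simp add: prox_minimizers_def is_arg_min_linorder)
qed

text \<open>Over a fixed \<open>x\<close>-component the proximal term is constant.\<close>
lemma run_slice_optimal:
  assumes "algorithm_run f V c a tb x u" "(x i (Suc k), w) \<in> V i"
  shows "f i (x i (Suc k), u i (Suc k)) \<le> f i (x i (Suc k), w)"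
  using run_step_prox[OF assms(1), of i k] assms(2)
  unfolding prox_minimizers_def is_arg_min_linorder mem_Collect_eq by fastforce

text \<open>
  Each \<open>f i (xs, us $ i)\<close> is an upper bound for the limit of the costs of agent \<open>i\<close>: the point
  \<open>us $ i\<close> can be moved into the slice over the current iterate at a price proportional to the
  distance from \<open>xs\<close>, and \<open>u i\<close> is optimal in that slice. Index 0 is excluded because the initial
  point is not the result of a minimization.
\<close>
lemma limit_point_is_minimizer:
  fixes V :: "'m::finite \<Rightarrow> ((real ^ 'n::finite) \<times> (real ^ 'p::finite)) set"
  assumes V: "\<And>i. compact (V i)" and f: "\<And>i. continuous_on (V i) (f i)"
    and G: "\<And>i. slice_lipschitz G (f i) (V i)"
    and run: "algorithm_run f V c a tb x u"
    and opt: "is_minimizer f V xs us" and x: "\<And>i. (\<lambda>k. x i k) \<longlonglongrightarrow> xs"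
    and lim: "limit_point (\<lambda>k. \<chi> i. u i k) ul"
  shows "is_minimizer f V xs ul"
proof -
  obtain r where r: "strict_mono r" "(\<lambda>n. \<chi> i. u i (r n)) \<longlonglongrightarrow> ul"
    using lim by (auto simp: limit_point_def)
  have u: "(\<lambda>n. u i (r n)) \<longlonglongrightarrow> ul $ i" for i
    using tendsto_vec_nth[OF r(2), of i] by simp
  have x: "(\<lambda>n. x i (r n)) \<longlonglongrightarrow> xs" for i
    using LIMSEQ_subseq_LIMSEQ[OF x r(1)] by (simp add: o_def)
  have xu: "(\<lambda>n. (x i (r n), u i (r n))) \<longlonglongrightarrow> (xs, ul $ i)" for i
    by (intro tendsto_Pair x u)
  have in_V: "(xs, ul $ i) \<in> V i" for i
    using closed_sequentially[OF compact_imp_closed[OF V] _ xu] run_in_V[OF run] by blast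
  have le: "f i (xs, ul $ i) \<le> f i (xs, us $ i)" for i
  proof (rule tendsto_le[OF sequentially_bot])
    show "(\<lambda>n. f i (x i (r n), u i (r n))) \<longlonglongrightarrow> f i (xs, ul $ i)"
      by (rule continuous_on_tendsto_compose[OF f xu in_V]) (simp add: run_in_V[OF run])
    have "(\<lambda>n. f i (xs, us $ i) + G * norm (xs - x i (r n))) \<longlonglongrightarrow> f i (xs, us $ i) + G * norm (xs - xs)"
      by (intro tendsto_intros x)
    then show "(\<lambda>n. f i (xs, us $ i) + G * norm (xs - x i (r n))) \<longlonglongrightarrow> f i (xs, us $ i)" by simp
    have "f i (x i (r n), u i (r n)) \<le> f i (xs, us $ i) + G * norm (xs - x i (r n))" if n: "n \<ge> 1" for n
    proof -
      have "r n \<noteq> 0" using n seq_suble[OF r(1), of n] by auto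
      then obtain k where k: "r n = Suc k" using not0_implies_Suc by blast
      have "(xs, us $ i) \<in> V i" using opt by (simp add: is_minimizer_iff mem_feasible_set)
      moreover have "x i (r n) \<in> slice_domain (V i)"
        using run_in_V[OF run] by (auto simp: slice_domain_def)
      ultimately obtain w where "(x i (r n), w) \<in> V i"
        "f i (x i (r n), w) \<le> f i (xs, us $ i) + G * norm (xs - x i (r n))"
        using slice_lipschitzD[OF G] by blast
      then show ?thesis
        using run_slice_optimal[OF run, of i k w] k by simp
    qed
    then show "\<forall>\<^sub>F n in sequentially.
        f i (x i (r n), u i (r n)) \<le> f i (xs, us $ i) + G * norm (xs - x i (r n))"
      by (auto simp: eventually_sequentially)
  qed
  have "objective f (xs, ul) \<le> objective f (xs, us)"
    unfolding objective_def by (intro sum_mono) (simp add: le)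
  then show ?thesis
    using opt in_V by (force simp: is_minimizer_iff mem_feasible_set)
qed

text \<open>
  Deviation, errors and nearby feasible points do not depend on the minimizer used in the descent
  inequality. An arbitrary minimizer \<open>(x0, u0)\<close> therefore yields the summability results, and only
  then is the limit \<open>\<zeta>\<close> extracted and the inequality used a second time with \<open>\<zeta>\<close> in place of
  \<open>(x0, u0)\<close>.
\<close>
lemma (in mixing_weights) iterates_converge:
  fixes V :: "'m \<Rightarrow> ((real ^ 'n::finite) \<times> (real ^ 'p::finite)) set"
  assumes f: "\<And>i. convex_on (S i) (f i)" "\<And>i. continuous_on (V i) (f i)"
    and V: "\<And>i. V i \<subseteq> S i" "\<And>i. compact (V i)" "\<And>i. convex (V i)"
    and ball: "\<rho> > 0" "\<And>i. cball p \<rho> \<subseteq> slice_domain (V i)"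
    and G: "G \<ge> 0" "\<And>i. slice_lipschitz G (f i) (V i)"
    and c: "\<And>k. c k > 0" "filterlim (\<lambda>K. \<Sum>k<K. c k) at_top sequentially" "summable (\<lambda>k. (c k)\<^sup>2)"
    and run: "algorithm_run f V c a tb x u" and ne: "feasible_set V \<noteq> {}"
  shows "\<exists>xs us. is_minimizer f V xs us \<and> (\<forall>i. (\<lambda>k. x i k) \<longlonglongrightarrow> xs)"
proof -
  define d where "d k = deviation (\<lambda>i. x i k)" for k
  define E where "E k = (\<Sum>i\<in>UNIV. (norm (x i (Suc k) - (\<Sum>j\<in>UNIV. a i j k *\<^sub>R x j k)))\<^sup>2)" for k
  define s where "s q k = (\<Sum>i\<in>UNIV. (norm (x i k - q))\<^sup>2)" for q k
  have d: "d k \<ge> 0" for k by (simp add: d_def deviation_nonneg)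
  have E: "E k \<ge> 0" for k by (simp add: E_def sum_nonneg)
  have s: "s q k \<ge> 0" for q k by (simp add: s_def sum_nonneg)
  have "bounded (\<Union>i. fst ` V i)"
    by (intro bounded_UN finite ballI bounded_fst compact_imp_bounded V(2))
  then obtain B where B: "\<And>i z. z \<in> V i \<Longrightarrow> norm (fst z) \<le> B"
    by (auto simp: bounded_iff)
  have xB: "norm (x i k) \<le> B" for i k
    using B[OF run_in_V[OF run]] by simp
  define \<kappa> where "\<kappa> = 1 + (norm p + B) / \<rho>"
  define H where "H = CARD('m) * G * \<kappa>"
  define near where "near k z \<longleftrightarrow> z \<in> feasible_set V \<and> (\<forall>i. norm (fst z - x i k) \<le> \<kappa> * d k) \<and>
    objective f z \<le> (\<Sum>i\<in>UNIV. f i (x i k, u i k)) + H * d k" for k z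
  have "\<exists>z. near k z" for k
    unfolding near_def d_def H_def \<kappa>_def Bex_def[symmetric]
    by (rule feasible_point_near[where V = V and f = f and v = "\<lambda>i. u i k"])
       (simp_all add: V(3) ball G run_in_V[OF run] xB)
  then obtain z where "\<And>k. near k (z k)" by metis
  then have z: "z k \<in> feasible_set V" "norm (fst (z k) - x i k) \<le> \<kappa> * d k"
    "objective f (z k) \<le> (\<Sum>i\<in>UNIV. f i (x i k, u i k)) + H * d k" for k i
    by (simp_all add: near_def)
  obtain x0 u0 where opt0: "is_minimizer f V x0 u0"
    using minimizer_exists[OF V(2) f(2) ne] by blast
  define h where "h k = objective f (z k) - objective f (x0, u0)" for k
  have h: "h k \<ge> 0" for k
    using opt0 z(1) by (simp add: h_def is_minimizer_iff)
  \<comment> \<open>descent towards any minimizer, the cost of disagreement moved to the right\<close>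
  have step: "s y (Suc k) + E k + 2 * (c k * h (Suc k)) \<le> s y k + 2 * H * (c k * d (Suc k))"
    if opt: "is_minimizer f V y w" for y w k
  proof -
    have "objective f (y, w) = objective f (x0, u0)"
      using opt opt0 by (intro antisym) (auto simp: is_minimizer_iff)
    moreover have "c k * (objective f (z (Suc k)))
        \<le> c k * ((\<Sum>i\<in>UNIV. f i (x i (Suc k), u i (Suc k))) + H * d (Suc k))"
      using z(3)[of "Suc k"] c(1)[of k] by (intro mult_left_mono) auto
    moreover have "(y, w) \<in> feasible_set V" using opt by (simp add: is_minimizer_iff)
    from one_step_descent[OF f(1) V(3,1) c(1)[of k] run this]
    have "s y (Suc k) + E k + 2 * c k * ((\<Sum>i\<in>UNIV. f i (x i (Suc k), u i (Suc k))) - objective f (y, w))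
        \<le> s y k" by (simp add: s_def E_def)
    ultimately show ?thesis by (simp add: h_def algebra_simps)
  qed
  obtain C0 C1 where C: "C1 \<ge> 0" "\<And>K. (\<Sum>k\<le>K. (d k)\<^sup>2) \<le> C0 + C1 * (\<Sum>k<K. E k)"
    using deviation_square_sum[of x] unfolding d_def E_def by blast
  have w0: "0 \<le> 2 * (c k * h (Suc k))" for k using c(1)[of k] h[of "Suc k"] by simp
  have sum_ch: "summable (\<lambda>k. 2 * (c k * h (Suc k)))" and sum_d: "summable (\<lambda>k. (d k)\<^sup>2)"
    by (rule descent_summable[of "s x0" E "\<lambda>k. 2 * (c k * h (Suc k))",
          OF s E w0 step[OF opt0] C c(3)])+
  have d_lim: "d \<longlonglongrightarrow> 0"
    using summable_LIMSEQ_zero[OF sum_d] by simp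
  have "summable (\<lambda>k. c k * h (Suc k))"
    using summable_mult[OF sum_ch, of "1 / 2"] by simp
  from subseq_to_zero_of_summable[OF c(1,2) h this]
  obtain r where r: "strict_mono r" "(\<lambda>n. h (Suc (r n))) \<longlonglongrightarrow> 0"
    by blast
  obtain \<zeta> t where t: "\<zeta> \<in> feasible_set V" "strict_mono t"
      "((\<lambda>n. z (Suc (r n))) \<circ> t) \<longlonglongrightarrow> \<zeta>"
  proof (rule seq_compactE[OF compact_imp_seq_compact[OF compact_feasible_set[OF V(2)]]])
    show "\<forall>n. z (Suc (r n)) \<in> feasible_set V" using z(1) by simp
  qed
  define \<sigma> where "\<sigma> n = Suc (r (t n))" for n
  have \<sigma>: "strict_mono \<sigma>"
    using r(1) t(2) by (simp add: \<sigma>_def strict_mono_def)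
  have z_lim: "(\<lambda>n. z (\<sigma> n)) \<longlonglongrightarrow> \<zeta>" using t(3) by (simp add: o_def \<sigma>_def)
  have "(\<lambda>n. h (\<sigma> n)) \<longlonglongrightarrow> 0"
    using LIMSEQ_subseq_LIMSEQ[OF r(2) t(2)] by (simp add: o_def \<sigma>_def)
  moreover have "(\<lambda>n. h (\<sigma> n)) \<longlonglongrightarrow> objective f \<zeta> - objective f (x0, u0)"
    unfolding h_def
    by (intro tendsto_diff tendsto_const
        continuous_on_tendsto_compose[OF continuous_on_objective[OF f(2)] z_lim t(1)])
       (simp add: z(1))
  ultimately have "objective f \<zeta> = objective f (x0, u0)"
    using LIMSEQ_unique by fastforce
  then have opt: "is_minimizer f V (fst \<zeta>) (snd \<zeta>)"
    using opt0 t(1) by (simp add: is_minimizer_iff)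
  \<comment> \<open>the squared distances to \<open>fst \<zeta>\<close> converge, so their limit can be read off along \<open>\<sigma>\<close>\<close>
  have "convergent (s (fst \<zeta>))"
  proof (rule convergent_of_almost_decreasing)
    show "summable (\<lambda>k. \<bar>H\<bar> * ((c k)\<^sup>2 + (d (Suc k))\<^sup>2))"
      using c(3) sum_d summable_Suc_iff[of "\<lambda>k. (d k)\<^sup>2"] by (intro summable_mult summable_add) simp_all
    show "s (fst \<zeta>) (Suc k) \<le> s (fst \<zeta>) k + \<bar>H\<bar> * ((c k)\<^sup>2 + (d (Suc k))\<^sup>2)" for k
    proof -
      have "2 * H * (c k * d (Suc k)) \<le> \<bar>H\<bar> * (2 * c k * d (Suc k))"
        using mult_right_mono[OF abs_ge_self[of H], of "2 * c k * d (Suc k)"] c(1)[of k] d[of "Suc k"]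
        by (simp add: ac_simps)
      also have "\<dots> \<le> \<bar>H\<bar> * ((c k)\<^sup>2 + (d (Suc k))\<^sup>2)"
        by (intro mult_left_mono sum_squares_bound) simp
      finally show ?thesis using step[OF opt, of k] E[of k] w0[of k] by linarith
    qed
  qed (simp_all add: s)
  then obtain l where l: "s (fst \<zeta>) \<longlonglongrightarrow> l" by (auto simp: convergent_def)
  have "(\<lambda>n. x i (\<sigma> n)) \<longlonglongrightarrow> fst \<zeta>" for i
  proof -
    have "(\<lambda>n. \<kappa> * d (\<sigma> n)) \<longlonglongrightarrow> \<kappa> * 0"
      using LIMSEQ_subseq_LIMSEQ[OF d_lim \<sigma>] by (intro tendsto_intros) (simp add: o_def)
    then have "(\<lambda>n. \<kappa> * d (\<sigma> n)) \<longlonglongrightarrow> 0" by simp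
    then have "(\<lambda>n. fst (z (\<sigma> n)) - x i (\<sigma> n)) \<longlonglongrightarrow> 0"
      by (rule Lim_null_comparison[rotated]) (simp add: z(2))
    from tendsto_diff[OF tendsto_fst[OF z_lim] this] show ?thesis by simp
  qed
  then have "(\<lambda>n. s (fst \<zeta>) (\<sigma> n)) \<longlonglongrightarrow> (\<Sum>i\<in>(UNIV::'m set). (norm (fst \<zeta> - fst \<zeta>))\<^sup>2)"
    unfolding s_def by (intro tendsto_intros)
  moreover have "(\<lambda>n. s (fst \<zeta>) (\<sigma> n)) \<longlonglongrightarrow> l"
    using LIMSEQ_subseq_LIMSEQ[OF l \<sigma>] by (simp add: o_def)
  ultimately have "l = 0" using LIMSEQ_unique by fastforce
  have "(\<lambda>k. x i k) \<longlonglongrightarrow> fst \<zeta>" for i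
  proof -
    have le: "(norm (x i k - fst \<zeta>))\<^sup>2 \<le> s (fst \<zeta>) k" for k
      unfolding s_def by (rule member_le_sum) auto
    have "s (fst \<zeta>) \<longlonglongrightarrow> 0" using l \<open>l = 0\<close> by simp
    then have "(\<lambda>k. (norm (x i k - fst \<zeta>))\<^sup>2) \<longlonglongrightarrow> 0"
      by (rule Lim_null_comparison[rotated]) (simp add: le)
    from tendsto_real_sqrt[OF this] have "(\<lambda>k. norm (x i k - fst \<zeta>)) \<longlonglongrightarrow> 0" by simp
    then show ?thesis by (rule LIM_zero_cancel[OF tendsto_norm_zero_cancel])
  qed
  with opt show ?thesis by blast
qed

theorem theorem1:
  fixes D :: "'m::finite \<Rightarrow> 'p::finite set"
    and f :: "'m \<Rightarrow> (real ^ 'n::finite) \<times> (real ^ 'p) \<Rightarrow> real"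
    and V :: "'m \<Rightarrow> ((real ^ 'n) \<times> (real ^ 'p)) set"
    and c :: "nat \<Rightarrow> real"
    and a :: "'m \<Rightarrow> 'm \<Rightarrow> nat \<Rightarrow> real"
    and tb :: "'m \<Rightarrow> ((real ^ 'n) \<times> (real ^ 'p)) set \<Rightarrow> (real ^ 'n) \<times> (real ^ 'p)"
    and x :: "'m \<Rightarrow> nat \<Rightarrow> real ^ 'n"
    and u :: "'m \<Rightarrow> nat \<Rightarrow> real ^ 'p"
  assumes V_space: "\<And>i. V i \<subseteq> UNIV \<times> coord_space (D i)"
    and A1_convex: "\<And>i. convex_on (UNIV \<times> coord_space (D i)) (f i)"
    and A1_lipschitz: "\<And>i. \<exists>L. L-lipschitz_on (UNIV \<times> coord_space (D i)) (f i)"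
    and A2_compact: "\<And>i. compact (V i)"
    and A2_convex: "\<And>i. convex (V i)"
    and A2_interior: "(top_of_set (joint_space D)) interior_of (feasible_set V) \<noteq> {}"
    and A3: "\<And>i. \<exists>L>0. \<forall>y\<in>slice_domain (V i). \<forall>y'\<in>slice_domain (V i).
               pompeiu_hausdorff (coord_space (D i)) (slice (V i) y) (slice (V i) y')
                 \<le> L * norm (y - y')"
    and A4_pos: "\<And>k. c k > 0"
    and A4_noninc: "decseq c"
    and A4_sum: "filterlim (\<lambda>K. \<Sum>k<K. c k) at_top sequentially"
    and A4_sum_sq: "summable (\<lambda>k. (c k)\<^sup>2)"
    and A5_weights: "\<exists>\<eta>. 0 < \<eta> \<and> \<eta> < 1 \<and>
               (\<forall>i j k. a i j k \<ge> 0 \<and> a i i k \<ge> \<eta> \<and> (a i j k > 0 \<longrightarrow> a i j k \<ge> \<eta>))"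
    and A5_row: "\<And>k i. (\<Sum>j\<in>UNIV. a i j k) = 1"
    and A5_column: "\<And>k j. (\<Sum>i\<in>UNIV. a i j k) = 1"
    and A6_connected: "\<And>i j. (i, j) \<in> (comm_edges_inf a)\<^sup>*"
    and A6_bounded: "\<exists>kbar\<ge>1. \<forall>e\<in>comm_edges_inf a. \<forall>k. \<exists>l\<in>{k..<k + kbar}. e \<in> comm_edges a l"
    and algorithm: "algorithm_run f V c a tb x u"
  shows "\<exists>xstar.
           (\<exists>ustar. is_minimizer f V xstar ustar) \<and>
           (\<forall>i. (\<lambda>k. norm (x i k - xstar)) \<longlonglongrightarrow> 0) \<and>
           (\<forall>ustar. limit_point (\<lambda>k. \<chi> i. u i k) ustar \<longrightarrow> is_minimizer f V xstar ustar)"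
proof -
  obtain \<eta> where \<eta>: "0 < \<eta>" "\<And>i j k. a i j k \<ge> 0" "\<And>i k. a i i k \<ge> \<eta>"
    "\<And>i j k. a i j k > 0 \<Longrightarrow> a i j k \<ge> \<eta>"
    using A5_weights by blast
  obtain kbar where kbar: "\<And>e k. e \<in> comm_edges_inf a \<Longrightarrow> \<exists>l\<in>{k..<k + kbar}. e \<in> comm_edges a l"
    using A6_bounded by blast
  interpret mixing_weights a \<eta> kbar
    by unfold_locales (use \<eta> A5_row A5_column A6_connected kbar in auto)
  have cont: "continuous_on (V i) (f i)" for i
    using A1_lipschitz[of i] V_space[of i] continuous_on_subset lipschitz_on_continuous_on by blast
  have "\<exists>G. slice_lipschitz G (f i) (V i)" for i
  proof -
    obtain L where "\<forall>y\<in>slice_domain (V i). \<forall>y'\<in>slice_domain (V i).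
        pompeiu_hausdorff (coord_space (D i)) (slice (V i) y) (slice (V i) y') \<le> L * norm (y - y')"
      using A3 by blast
    moreover obtain M where "M-lipschitz_on (UNIV \<times> coord_space (D i)) (f i)"
      using A1_lipschitz by blast
    ultimately show ?thesis
      using slice_lipschitz_of_hausdorff_lipschitz[OF V_space A2_compact] by blast
  qed
  then obtain g where g: "\<And>i. slice_lipschitz (g i) (f i) (V i)" by metis
  define G where "G = (\<Sum>i\<in>UNIV. \<bar>g i\<bar>)"
  have "G \<ge> 0" by (simp add: G_def sum_nonneg)
  have G: "slice_lipschitz G (f i) (V i)" for i
  proof (rule slice_lipschitz_mono[OF g])
    have "\<bar>g i\<bar> \<le> G" unfolding G_def by (rule member_le_sum) auto
    then show "g i \<le> G" by simp
  qed
  obtain p \<rho> where ball: "\<rho> > 0" "\<And>i. cball p \<rho> \<subseteq> slice_domain (V i)"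
    using common_ball_of_interior[OF A2_interior] by blast
  have "feasible_set V \<noteq> {}"
    using A2_interior interior_of_subset[of "top_of_set (joint_space D)" "feasible_set V"] by auto
  then obtain xs us where opt: "is_minimizer f V xs us" and lim: "\<And>i. (\<lambda>k. x i k) \<longlonglongrightarrow> xs"
    using iterates_converge[OF A1_convex cont V_space A2_compact A2_convex ball \<open>G \<ge> 0\<close> G
        A4_pos A4_sum A4_sum_sq algorithm] by blast
  have "(\<lambda>k. norm (x i k - xs)) \<longlonglongrightarrow> 0" for i
    using lim[of i] LIM_zero tendsto_norm_zero by blast
  then show ?thesis
    using opt limit_point_is_minimizer[OF A2_compact cont G algorithm opt lim] by blast
qed

end
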